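(* Let $G$ be a finite group acting on a compactly generated Hausdorff path connected space $X$ with basepoint $x_0$, and let $n\ge 2$. Then the sequence $$0\to \tau_{n-1}(\Omega X,\overline{x_0})\to \sigma_n(X,x_0,G)\to \sigma_{n-1}(X,x_0,G)\to 1$$ is split exact, where $\overline{x_0}$ is the constant loop at $x_0$, the right-hand map is the canonical projection, and the splitting is a section $\sigma_{n-1}(X,x_0,G)\to\sigma_n(X,x_0,G)$ of the right-hand map.
   Context: Let $I=[0,1]$, let $T^{m}$ denote the $m$-dimensional torus, i.e. the product of $m$ copies of $I/\{0,1\}$ ($T^0$ is a point), and for $n\ge 1$ put $C_n=I\times T^{n-1}$. Fox torus homotopy groups: for a space $Z$ with basepoint $z_0$, $\tau_n(Z,z_0)=\pi_1(Z^{T^{n-1}},c_{z_0})$, where $Z^{T^{n-1}}$ is the space of maps $T^{n-1}\to Z$ and $c_{z_0}$ is the constant map at $z_0$. Rhodes groups: let $X$ be a $G$-space with basepoint $x_0$. A map $f:C_n\to X$ is of order $g\in G$ if $f(0,t_2,\ldots,t_n)=x_0$ and $f(1,t_2,\ldots,t_n)=gx_0$ for all $(t_2,\ldots,t_n)\in T^{n-1}$. Let $[f;g]$ denote the homotopy class of $f$ through maps of order $g$ (together with $g$), and let $\sigma_n(X,x_0,G)$ be the set of all such classes. It is a group under $[f';g']*[f;g]=[f'+g'f;\,g'g]$, where $g'f$ is the map $f$ followed by the action of $g'$ and $+$ denotes concatenation in the $I$-coordinate. $\Omega X$ is the space of loops in $X$ based at $x_0$. The maps are as follows. The canonical projection $\sigma_n(X,x_0,G)\to\sigma_{n-1}(X,x_0,G)$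 sends $[f;g]$ to $[f\circ i_n;g]$, where $i_n:C_{n-1}\to C_n$, $i_n(t_1,\ldots,t_{n-1})=(t_1,\ldots,t_{n-1},0)$. The section $\sigma_{n-1}(X,x_0,G)\to\sigma_n(X,x_0,G)$ is induced by precomposition with the projection $C_n\to C_{n-1}$, $(t_1,\ldots,t_n)\mapsto(t_1,\ldots,t_{n-1})$. The left-hand map is the composite of the homomorphism $\tau_{n-1}(\Omega X,\overline{x_0})\to\tau_n(X,x_0)$ of Fox's split exact sequence, sending the class of $h:I\times T^{n-2}\to\Omega X$ to the class of $(t_1,\ldots,t_n)\mapsto h(t_1,\ldots,t_{n-1})(t_n)$, with the inclusion $\tau_n(X,x_0)\to\sigma_n(X,x_0,G)$, $[f]\mapsto[f;e]$, where $e\in G$ is the identity. *)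

theory Defs
  imports "HOL-Analysis.Analysis" "HOL-Algebra.Group_Action"
begin

section \<open>Tori and mapping spaces\<close>

abbreviation unit_interval :: "real topology" where
  "unit_interval \<equiv> top_of_set {0..1}"

definition quotient_topology :: "'a topology \<Rightarrow> ('a \<Rightarrow> 'b) \<Rightarrow> 'b topology" where
  "quotient_topology X q =
     topology (\<lambda>U. U \<subseteq> q ` topspace X \<and> openin X {x \<in> topspace X. q x \<in> U})"

lemma openin_quotient_topology:
  "openin (quotient_topology X q) U \<longleftrightarrow>
     U \<subseteq> q ` topspace X \<and> openin X {x \<in> topspace X. q x \<in> U}"
proof -
  have "istopology (\<lambda>U. U \<subseteq> q ` topspace X \<and> openin X {x \<in> topspace X. q x \<in> U})"
    unfolding istopology_def
  proof (intro conjI allI impI; (elim conjE)?)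
    fix S T assume "openin X {x \<in> topspace X. q x \<in> S}" "openin X {x \<in> topspace X. q x \<in> T}"
    then have "openin X ({x \<in> topspace X. q x \<in> S} \<inter> {x \<in> topspace X. q x \<in> T})" by blast
    also have "{x \<in> topspace X. q x \<in> S} \<inter> {x \<in> topspace X. q x \<in> T}
      = {x \<in> topspace X. q x \<in> S \<inter> T}" by auto
    finally show "openin X {x \<in> topspace X. q x \<in> S \<inter> T}" .
  next
    fix \<K> assume "\<forall>K\<in>\<K>. K \<subseteq> q ` topspace X \<and> openin X {x \<in> topspace X. q x \<in> K}"
    then have "openin X (\<Union>K\<in>\<K>. {x \<in> topspace X. q x \<in> K})" by blast
    also have "(\<Union>K\<in>\<K>. {x \<in> topspace X. q x \<in> K}) = {x \<in> topspace X. q x \<in> \<Union>\<K>}" by auto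
    finally show "openin X {x \<in> topspace X. q x \<in> \<Union>\<K>}" .
  qed auto
  then show ?thesis by (simp add: quotient_topology_def)
qed

lemma topspace_quotient_topology [simp]:
  "topspace (quotient_topology X q) = q ` topspace X"
proof
  show "topspace (quotient_topology X q) \<subseteq> q ` topspace X"
    by (meson openin_quotient_topology openin_topspace)
  have "{x \<in> topspace X. q x \<in> q ` topspace X} = topspace X" by auto
  then have "openin (quotient_topology X q) (q ` topspace X)"
    by (simp add: openin_quotient_topology)
  then show "q ` topspace X \<subseteq> topspace (quotient_topology X q)"
    by (rule openin_subset)
qed

lemma quotient_map_quotient_topology: "quotient_map X (quotient_topology X q) q"
  by (auto simp: quotient_map_def openin_quotient_topology)

text \<open>The point of \<open>I/{0,1}\<close> represented by \<open>t\<close>, as an equivalence class of real numbers.\<close>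

definition circle_class :: "real \<Rightarrow> real set" where
  "circle_class t = (if t \<in> {0, 1} then {0, 1} else {t})"

definition circle_top :: "real set topology" where
  "circle_top = quotient_topology unit_interval circle_class"

text \<open>The \<open>m\<close> factors of \<open>T\<^sup>m\<close> are indexed by \<open>2, \<dots>, m + 1\<close>, so that in
  \<open>C\<^sub>n = I \<times> T\<^sup>n\<^sup>-\<^sup>1\<close> the component \<open>s i\<close> of a point \<open>(t, s)\<close> is its \<open>i\<close>-th coordinate
  \<open>t\<^sub>i\<close> and \<open>t\<close> is its first coordinate \<open>t\<^sub>1\<close>.\<close>

definition torus :: "nat \<Rightarrow> (nat \<Rightarrow> real set) topology" where
  "torus m = product_topology (\<lambda>_. circle_top) {2..Suc m}"

definition cyl :: "nat \<Rightarrow> (real \<times> (nat \<Rightarrow> real set)) topology" where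
  "cyl n = prod_topology unit_interval (torus (n - 1))"

text \<open>The space \<open>Z\<^sup>K\<close> of continuous maps, with the compact-open topology. Its points are extensional,
  so that they are determined by their values on \<open>K\<close>.\<close>

definition maps :: "'k topology \<Rightarrow> 'z topology \<Rightarrow> ('k \<Rightarrow> 'z) set" where
  "maps K Z = {f \<in> extensional (topspace K). continuous_map K Z f}"

definition mapping_space :: "'k topology \<Rightarrow> 'z topology \<Rightarrow> ('k \<Rightarrow> 'z) topology" where
  "mapping_space K Z =
     topology_generated_by {{f \<in> maps K Z. f ` C \<subseteq> U} | C U. compactin K C \<and> openin Z U}"

lemma topspace_mapping_space [simp]: "topspace (mapping_space K Z) = maps K Z"
proof -
  have "maps K Z \<in> {{f \<in> maps K Z. f ` C \<subseteq> U} | C U. compactin K C \<and> openin Z U}"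
    by (rule CollectI, rule exI[of _ "{}"]) auto
  then show ?thesis
    unfolding mapping_space_def topology_generated_by_topspace by blast
qed

definition loop_space :: "'x topology \<Rightarrow> 'x \<Rightarrow> (real \<Rightarrow> 'x) topology" where
  "loop_space X x0 = subtopology (mapping_space unit_interval X) {p. p 0 = x0 \<and> p 1 = x0}"

definition const_loop :: "'x \<Rightarrow> real \<Rightarrow> 'x" where
  "const_loop x0 = (\<lambda>t\<in>{0..1}. x0)"


section \<open>Fundamental groups and Fox torus homotopy groups\<close>

text \<open>Library \<open>joinpaths\<close> is only available on types of class \<open>topological_space\<close>.\<close>

definition concat_path :: "(real \<Rightarrow> 'a) \<Rightarrow> (real \<Rightarrow> 'a) \<Rightarrow> real \<Rightarrow> 'a" where
  "concat_path p q = (\<lambda>t. if t \<le> 1/2 then p (2 * t) else q (2 * t - 1))"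

definition based_loop :: "'z \<Rightarrow> (real \<Rightarrow> 'z) \<Rightarrow> bool" where
  "based_loop z0 p \<longleftrightarrow> p 0 = z0 \<and> p 1 = z0"

text \<open>Maps are HOL functions whose values outside the domain are irrelevant: \<open>homotopic_with\<close> identifies
  maps that agree on the domain.\<close>

definition loop_class :: "'z topology \<Rightarrow> 'z \<Rightarrow> (real \<Rightarrow> 'z) \<Rightarrow> (real \<Rightarrow> 'z) set" where
  "loop_class Z z0 p = {q. homotopic_with (based_loop z0) unit_interval Z p q}"

text \<open>Operations on homotopy classes are written as unions over all representatives; since classes
  partition the maps, such a union is a single class exactly when the operation is well defined.\<close>

definition fundamental_group :: "'z topology \<Rightarrow> 'z \<Rightarrow> (real \<Rightarrow> 'z) set monoid" where
  "fundamental_group Z z0 =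
     \<lparr>carrier = {loop_class Z z0 p | p. pathin Z p \<and> based_loop z0 p},
      mult = (\<lambda>A B. \<Union>p\<in>A. \<Union>q\<in>B. loop_class Z z0 (concat_path p q)),
      one = loop_class Z z0 (\<lambda>_. z0)\<rparr>"

definition const_map :: "'k topology \<Rightarrow> 'z \<Rightarrow> 'k \<Rightarrow> 'z" where
  "const_map K z0 = (\<lambda>s\<in>topspace K. z0)"

definition fox_group ::
    "nat \<Rightarrow> 'z topology \<Rightarrow> 'z \<Rightarrow> (real \<Rightarrow> (nat \<Rightarrow> real set) \<Rightarrow> 'z) set monoid" where
  "fox_group n Z z0 =
     fundamental_group (mapping_space (torus (n - 1)) Z) (const_map (torus (n - 1)) z0)"


section \<open>Rhodes groups\<close>

definition G_space :: "('g, 'm) monoid_scheme \<Rightarrow> ('g \<Rightarrow> 'x \<Rightarrow> 'x) \<Rightarrow> 'x topology \<Rightarrow> bool" where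
  "G_space G \<phi> X \<longleftrightarrow>
     group_action G (topspace X) \<phi> \<and>
     continuous_map (prod_topology (discrete_topology (carrier G)) X) X (\<lambda>(g, x). \<phi> g x)"

definition of_order ::
    "nat \<Rightarrow> ('g \<Rightarrow> 'x \<Rightarrow> 'x) \<Rightarrow> 'x \<Rightarrow> 'g \<Rightarrow> (real \<times> (nat \<Rightarrow> real set) \<Rightarrow> 'x) \<Rightarrow> bool" where
  "of_order n \<phi> x0 g f \<longleftrightarrow>
     (\<forall>s \<in> topspace (torus (n - 1)). f (0, s) = x0 \<and> f (1, s) = \<phi> g x0)"

definition rhodes_class ::
    "nat \<Rightarrow> 'x topology \<Rightarrow> 'x \<Rightarrow> ('g \<Rightarrow> 'x \<Rightarrow> 'x) \<Rightarrow> (real \<times> (nat \<Rightarrow> real set) \<Rightarrow> 'x) \<Rightarrow> 'g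
      \<Rightarrow> (real \<times> (nat \<Rightarrow> real set) \<Rightarrow> 'x) set \<times> 'g" where
  "rhodes_class n X x0 \<phi> f g = ({f'. homotopic_with (of_order n \<phi> x0 g) (cyl n) X f f'}, g)"

definition concat_cyl :: "(real \<times> 'b \<Rightarrow> 'a) \<Rightarrow> (real \<times> 'b \<Rightarrow> 'a) \<Rightarrow> real \<times> 'b \<Rightarrow> 'a" where
  "concat_cyl f f' = (\<lambda>(t, s). concat_path (\<lambda>u. f (u, s)) (\<lambda>u. f' (u, s)) t)"

definition rhodes_group ::
    "nat \<Rightarrow> 'x topology \<Rightarrow> 'x \<Rightarrow> ('g, 'm) monoid_scheme \<Rightarrow> ('g \<Rightarrow> 'x \<Rightarrow> 'x)
      \<Rightarrow> ((real \<times> (nat \<Rightarrow> real set) \<Rightarrow> 'x) set \<times> 'g) monoid" where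
  "rhodes_group n X x0 G \<phi> =
     \<lparr>carrier = {rhodes_class n X x0 \<phi> f g | f g.
                   g \<in> carrier G \<and> continuous_map (cyl n) X f \<and> of_order n \<phi> x0 g f},
      mult = (\<lambda>(A', g') (A, g).
                (\<Union>f'\<in>A'. \<Union>f\<in>A.
                    fst (rhodes_class n X x0 \<phi> (concat_cyl f' (\<lambda>u. \<phi> g' (f u))) (g' \<otimes>\<^bsub>G\<^esub> g)),
                 g' \<otimes>\<^bsub>G\<^esub> g)),
      one = rhodes_class n X x0 \<phi> (\<lambda>_. x0) \<one>\<^bsub>G\<^esub>\<rparr>"


section \<open>The maps of the sequence\<close>

definition rhodes_induced ::
    "nat \<Rightarrow> 'x topology \<Rightarrow> 'x \<Rightarrow> ('g \<Rightarrow> 'x \<Rightarrow> 'x)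
      \<Rightarrow> (real \<times> (nat \<Rightarrow> real set) \<Rightarrow> real \<times> (nat \<Rightarrow> real set))
      \<Rightarrow> (real \<times> (nat \<Rightarrow> real set) \<Rightarrow> 'x) set \<times> 'g
      \<Rightarrow> (real \<times> (nat \<Rightarrow> real set) \<Rightarrow> 'x) set \<times> 'g" where
  "rhodes_induced k X x0 \<phi> j = (\<lambda>(A, g). (\<Union>f\<in>A. fst (rhodes_class k X x0 \<phi> (f \<circ> j) g), g))"

definition cyl_incl :: "nat \<Rightarrow> real \<times> (nat \<Rightarrow> real set) \<Rightarrow> real \<times> (nat \<Rightarrow> real set)" where
  "cyl_incl n = (\<lambda>(t, s). (t, s(n := circle_class 0)))"

definition cyl_proj :: "nat \<Rightarrow> real \<times> (nat \<Rightarrow> real set) \<Rightarrow> real \<times> (nat \<Rightarrow> real set)" where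
  "cyl_proj n = (\<lambda>(t, s). (t, restrict s {2..n - 1}))"

text \<open>\<open>\<sigma>\<^sub>n \<rightarrow> \<sigma>\<^sub>n\<^sub>-\<^sub>1\<close> and its section \<open>\<sigma>\<^sub>n\<^sub>-\<^sub>1 \<rightarrow> \<sigma>\<^sub>n\<close>.\<close>

definition rhodes_projection where
  "rhodes_projection n X x0 \<phi> = rhodes_induced (n - 1) X x0 \<phi> (cyl_incl n)"

definition rhodes_section where
  "rhodes_section n X x0 \<phi> = rhodes_induced n X x0 \<phi> (cyl_proj n)"

text \<open>The map \<open>(t\<^sub>1, \<dots>, t\<^sub>n) \<mapsto> h(t\<^sub>1, \<dots>, t\<^sub>n\<^sub>-\<^sub>1)(t\<^sub>n)\<close>, where \<open>h\<close> is given by its adjoint, a path in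
  \<open>(\<Omega>X)\<^bsup>T\<^sup>n\<^sup>-\<^sup>2\<^esup>\<close>, and the result likewise by its adjoint, a path in \<open>X\<^bsup>T\<^sup>n\<^sup>-\<^sup>1\<^esup>\<close>. A loop has the same
  value at all representatives of the point \<open>s n\<close> of \<open>I/{0,1}\<close>.\<close>

definition unloop ::
    "nat \<Rightarrow> (real \<Rightarrow> (nat \<Rightarrow> real set) \<Rightarrow> real \<Rightarrow> 'x) \<Rightarrow> real \<Rightarrow> (nat \<Rightarrow> real set) \<Rightarrow> 'x" where
  "unloop n p = (\<lambda>t. \<lambda>s\<in>topspace (torus (n - 1)). p t (restrict s {2..n - 1}) (SOME u. u \<in> s n))"

definition fox_map ::
    "nat \<Rightarrow> 'x topology \<Rightarrow> 'x \<Rightarrow> (real \<Rightarrow> (nat \<Rightarrow> real set) \<Rightarrow> real \<Rightarrow> 'x) set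
      \<Rightarrow> (real \<Rightarrow> (nat \<Rightarrow> real set) \<Rightarrow> 'x) set" where
  "fox_map n X x0 A =
     (\<Union>p\<in>A. loop_class (mapping_space (torus (n - 1)) X) (const_map (torus (n - 1)) x0)
                (unloop n p))"

text \<open>The inclusion \<open>\<tau>\<^sub>n \<rightarrow> \<sigma>\<^sub>n\<close>, \<open>[f] \<mapsto> [f; e]\<close>; a path in \<open>X\<^bsup>T\<^sup>n\<^sup>-\<^sup>1\<^esup>\<close> is turned into a map
  \<open>C\<^sub>n \<rightarrow> X\<close> by uncurrying.\<close>

definition fox_to_rhodes ::
    "nat \<Rightarrow> 'x topology \<Rightarrow> 'x \<Rightarrow> ('g, 'm) monoid_scheme \<Rightarrow> ('g \<Rightarrow> 'x \<Rightarrow> 'x)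
      \<Rightarrow> (real \<Rightarrow> (nat \<Rightarrow> real set) \<Rightarrow> 'x) set \<Rightarrow> (real \<times> (nat \<Rightarrow> real set) \<Rightarrow> 'x) set \<times> 'g" where
  "fox_to_rhodes n X x0 G \<phi> A =
     (\<Union>q\<in>A. fst (rhodes_class n X x0 \<phi> (case_prod q) \<one>\<^bsub>G\<^esub>), \<one>\<^bsub>G\<^esub>)"

text \<open>The library predicate \<open>exact_seq\<close> requires all groups of a sequence to have the same element
  type.\<close>

definition split_short_exact ::
    "('a, 'm) monoid_scheme \<Rightarrow> ('b, 'n) monoid_scheme \<Rightarrow> ('c, 'k) monoid_scheme
      \<Rightarrow> ('a \<Rightarrow> 'b) \<Rightarrow> ('b \<Rightarrow> 'c) \<Rightarrow> ('c \<Rightarrow> 'b) \<Rightarrow> bool" where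
  "split_short_exact A B C i p s \<longleftrightarrow>
     group_hom A B i \<and> group_hom B C p \<and> group_hom C B s \<and>
     inj_on i (carrier A) \<and>
     i ` carrier A = kernel B C p \<and>
     p ` carrier B = carrier C \<and>
     (\<forall>c \<in> carrier C. p (s c) = c)"

end

theory Submission
  imports Defs
begin

text \<open>
  A map \<open>C\<^sub>n \<rightarrow> X\<close> of order \<open>g\<close> is a path, in the first coordinate, of maps \<open>T\<^sup>n\<^sup>-\<^sup>1 \<rightarrow> X\<close>.
  Concatenation of such paths is associative, unital and invertible up to reparametrizing the first
  coordinate, so the Rhodes groups are groups; precomposition with maps between the tori commutes with
  concatenation and hence induces homomorphisms. The projection and its section arise from the inclusion
  \<open>T\<^sup>n\<^sup>-\<^sup>2 \<rightarrow> T\<^sup>n\<^sup>-\<^sup>1\<close> at last coordinate \<open>0\<close> and from the map forgetting the last coordinate; the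
  inclusion followed by forgetting is the identity, which gives the splitting.

  The kernel is found by geometry. By the exponential law for compact Hausdorff spaces, a based
  loop in \<open>(\<Omega>X)\<^bsup>T\<^sup>n\<^sup>-\<^sup>2\<^esup>\<close> is the same as a map on \<open>C\<^sub>n\<close> that takes the value \<open>x0\<close> at \<open>t\<^sub>1 = 0\<close>,
  at \<open>t\<^sub>1 = 1\<close> and at \<open>t\<^sub>n = 0\<close>; call it a loop map. Two facts then identify the classes of loop maps
  with the kernel.

  \<^item> Exactness (\<open>deform_to_loop_map\<close>): if the restriction of \<open>f\<close> to \<open>t\<^sub>n = 0\<close> is null-homotopic, the
    homotopy extension property moves \<open>f\<close> to a loop map.

  \<^item> Injectivity (\<open>homotopic_loop_map\<close>): a homotopy between two loop maps that need not be constant at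
    \<open>t\<^sub>n = 0\<close> can be replaced by a homotopy through loop maps. This uses the group structure given by the first
    coordinate: the homotopy is divided by its own restriction to \<open>t\<^sub>n = 0\<close>.

  Homotopy extension is made explicit by attaching a collar in the last coordinate
  (\<open>homotopy_extension_torus\<close>). The group laws of the torus homotopy group of \<open>\<Omega>X\<close> are read off from the
  kernel subgroup, onto which it is mapped bijectively and multiplicatively.

  In the lemmas the dimension is written \<open>n = m + 2\<close>, so that the last coordinate of a torus point has
  the index \<open>Suc (Suc m)\<close>.
\<close>

section \<open>Homotopies of maps on cylinders\<close>

lemma continuous_map_apply_pair:
  assumes "continuous_map (prod_topology A B) X F"
    and "continuous_map Y A a" and "continuous_map Y B b"
  shows "continuous_map Y X (\<lambda>y. F (a y, b y))"
  using continuous_map_compose[OF continuous_map_pairedI[OF assms(2,3)] assms(1)]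
  by (simp add: o_def)

lemma continuous_map_prod_assoc:
  assumes "continuous_map (prod_topology (prod_topology A B) C) X F"
  shows "continuous_map (prod_topology A (prod_topology B C)) X (\<lambda>(a, b, c). F ((a, b), c))"
  unfolding case_prod_unfold
  by (intro continuous_map_apply_pair[OF assms] continuous_map_pairedI continuous_map_fst
      continuous_map_compose[OF continuous_map_snd continuous_map_fst, unfolded o_def]
      continuous_map_compose[OF continuous_map_snd continuous_map_snd, unfolded o_def])

lemma continuous_map_prod_assoc':
  assumes "continuous_map (prod_topology A (prod_topology B C)) X F"
  shows "continuous_map (prod_topology (prod_topology A B) C) X (\<lambda>((a, b), c). F (a, b, c))"
  unfolding case_prod_unfold
  by (intro continuous_map_apply_pair[OF assms] continuous_map_pairedI continuous_map_snd
      continuous_map_compose[OF continuous_map_fst continuous_map_fst, unfolded o_def]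
      continuous_map_compose[OF continuous_map_fst continuous_map_snd, unfolded o_def])

lemma continuous_map_into_unit_interval:
  "continuous_map Y unit_interval f \<longleftrightarrow>
     continuous_map Y euclideanreal f \<and> (\<forall>y\<in>topspace Y. 0 \<le> f y \<and> f y \<le> 1)"
  by (auto simp: continuous_map_in_subtopology)

lemma continuous_map_real_fst [continuous_intros]:
  "continuous_map Y (prod_topology unit_interval S) f \<Longrightarrow>
     continuous_map Y euclideanreal (\<lambda>y. fst (f y))"
  using continuous_map_compose[OF _ continuous_map_fst, of Y unit_interval S f]
  by (auto simp: o_def continuous_map_into_unit_interval)

lemma continuous_map_if_le:
  assumes "continuous_map Y euclideanreal p" and "continuous_map Y euclideanreal q"
    and "continuous_map Y X f" and "continuous_map Y X g"
    and "\<And>y. y \<in> topspace Y \<Longrightarrow> p y = q y \<Longrightarrow> f y = g y"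
  shows "continuous_map Y X (\<lambda>y. if p y \<le> q y then f y else g y)"
  using assms by (intro continuous_map_cases_le continuous_map_from_subtopology) auto

lemma continuous_map_concat_cyl:
  assumes f: "continuous_map (prod_topology unit_interval S) X f"
    and f': "continuous_map (prod_topology unit_interval S) X f'"
    and eq: "\<And>s. s \<in> topspace S \<Longrightarrow> f (1, s) = f' (0, s)"
  shows "continuous_map (prod_topology unit_interval S) X (concat_cyl f f')"
proof -
  let ?Y = "prod_topology unit_interval S"
  have "continuous_map ?Y X (\<lambda>z. if fst z \<le> 1/2
      then f (min 1 (2 * fst z), snd z) else f' (max 0 (2 * fst z - 1), snd z))"
  proof (rule continuous_map_if_le)
    show "continuous_map ?Y X (\<lambda>z. f (min 1 (2 * fst z), snd z))"
      by (rule continuous_map_apply_pair[OF f])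
        (auto simp: continuous_map_into_unit_interval continuous_map_snd
              intro!: continuous_intros)
    show "continuous_map ?Y X (\<lambda>z. f' (max 0 (2 * fst z - 1), snd z))"
      by (rule continuous_map_apply_pair[OF f'])
        (auto simp: continuous_map_into_unit_interval continuous_map_snd
              intro!: continuous_intros)
  qed (auto simp: eq intro!: continuous_intros)
  then show ?thesis
    by (rule continuous_map_eq) (auto simp: concat_cyl_def concat_path_def min_absorb2 max_absorb2)
qed

text \<open>Concatenation in the first coordinate of a homotopy is concatenation of maps whose parameter
  space has been enlarged by the homotopy parameter, so continuity carries over.\<close>

lemma homotopic_concat_cyl:
  assumes f: "homotopic_with P (prod_topology unit_interval S) X f f1"
    and f': "homotopic_with Q (prod_topology unit_interval S) X f' f1'"
    and R: "\<And>k k'. P k \<Longrightarrow> Q k' \<Longrightarrow> R (concat_cyl k k')"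
    and eq: "\<And>k k' s. P k \<Longrightarrow> Q k' \<Longrightarrow> s \<in> topspace S \<Longrightarrow> k (1, s) = k' (0, s)"
  shows "homotopic_with R (prod_topology unit_interval S) X
           (concat_cyl f f') (concat_cyl f1 f1')"
proof -
  let ?C = "prod_topology unit_interval S"
  obtain h where h: "continuous_map (prod_topology unit_interval ?C) X h"
      "\<And>z. h (0, z) = f z" "\<And>z. h (1, z) = f1 z" "\<And>u. u \<in> {0..1} \<Longrightarrow> P (\<lambda>z. h (u, z))"
    using f unfolding homotopic_with_def by blast
  obtain h' where h': "continuous_map (prod_topology unit_interval ?C) X h'"
      "\<And>z. h' (0, z) = f' z" "\<And>z. h' (1, z) = f1' z" "\<And>u. u \<in> {0..1} \<Longrightarrow> Q (\<lambda>z. h' (u, z))"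
    using f' unfolding homotopic_with_def by blast
  define k where "k = (\<lambda>(t, u, s). h (u, t, s))"
  define k' where "k' = (\<lambda>(t, u, s). h' (u, t, s))"
  have swap: "continuous_map (prod_topology unit_interval (prod_topology unit_interval S))
      (prod_topology unit_interval (prod_topology unit_interval S)) (\<lambda>(t, u, s). (u, t, s))"
    unfolding case_prod_unfold
    by (intro continuous_map_pairedI continuous_map_snd_of continuous_map_fst_of
        continuous_map_fst continuous_map_snd
        continuous_map_compose[OF continuous_map_snd continuous_map_fst, unfolded o_def]
        continuous_map_compose[OF continuous_map_snd continuous_map_snd, unfolded o_def])
  have "continuous_map (prod_topology unit_interval (prod_topology unit_interval S)) X
      (concat_cyl k k')"
  proof (rule continuous_map_concat_cyl)
    show "continuous_map (prod_topology unit_interval (prod_topology unit_interval S)) X k"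
      using continuous_map_compose[OF swap h(1)] by (simp add: k_def o_def case_prod_unfold)
    show "continuous_map (prod_topology unit_interval (prod_topology unit_interval S)) X k'"
      using continuous_map_compose[OF swap h'(1)] by (simp add: k'_def o_def case_prod_unfold)
    show "k (1, s) = k' (0, s)" if "s \<in> topspace (prod_topology unit_interval S)" for s
      using that eq[OF h(4) h'(4), of "fst s" "fst s" "snd s"] by (auto simp: k_def k'_def)
  qed
  from continuous_map_compose[OF swap this]
  have "continuous_map (prod_topology unit_interval ?C) X (\<lambda>(u, t, s). concat_cyl k k' (t, u, s))"
    by (simp add: o_def case_prod_unfold)
  moreover have *: "(\<lambda>(u, t, s). concat_cyl k k' (t, u, s))
      = (\<lambda>(u, z). concat_cyl (\<lambda>z. h (u, z)) (\<lambda>z. h' (u, z)) z)"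
    by (auto simp: concat_cyl_def concat_path_def k_def k'_def)
  ultimately show ?thesis
    unfolding homotopic_with_def
    by (intro exI[of _ "\<lambda>(u, z). concat_cyl (\<lambda>z. h (u, z)) (\<lambda>z. h' (u, z)) z"])
      (auto simp: h(2,3) h'(2,3) intro!: R h(4) h'(4))
qed

text \<open>Any two reparametrizations of the interval coordinate with the same end values are joined by
  the straight-line homotopy. This single fact yields associativity, units and inverses.\<close>

lemma homotopic_reparametrize:
  assumes f: "continuous_map (prod_topology unit_interval S) X f"
    and \<rho>: "continuous_map unit_interval unit_interval \<rho>"
    and \<rho>': "continuous_map unit_interval unit_interval \<rho>'"
    and ends: "\<rho>' 0 = \<rho> 0" "\<rho>' 1 = \<rho> 1"
    and P: "\<And>\<tau>. \<tau> \<in> {0..1} \<rightarrow> {0..1} \<Longrightarrow> \<tau> 0 = \<rho> 0 \<Longrightarrow> \<tau> 1 = \<rho> 1 \<Longrightarrow> P (\<lambda>(t, s). f (\<tau> t, s))"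
  shows "homotopic_with P (prod_topology unit_interval S) X
           (\<lambda>(t, s). f (\<rho> t, s)) (\<lambda>(t, s). f (\<rho>' t, s))"
proof -
  let ?C = "prod_topology unit_interval S"
  let ?H = "\<lambda>(u, t, s). f ((1 - u) * \<rho> t + u * \<rho>' t, s)"
  have range: "(1 - u) * \<rho> t + u * \<rho>' t \<in> {0..1}" if "u \<in> {0..1}" "t \<in> {0..1}" for u t
  proof -
    have "\<rho> t \<in> {0..1}" "\<rho>' t \<in> {0..1}"
      using \<rho> \<rho>' that by (auto simp: continuous_map_into_unit_interval)
    then show ?thesis
      using convexD_alt[OF convex_closed_interval[of 0 "1::real"], of "\<rho> t" "\<rho>' t" u] that by auto
  qed
  have time: "continuous_map (prod_topology unit_interval ?C) unit_interval (\<lambda>z. fst (snd z))"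
    using continuous_map_compose[OF continuous_map_snd continuous_map_fst] by (simp add: o_def)
  have re: "continuous_map (prod_topology unit_interval ?C) euclideanreal (\<lambda>z. \<rho> (fst (snd z)))"
    "continuous_map (prod_topology unit_interval ?C) euclideanreal (\<lambda>z. \<rho>' (fst (snd z)))"
    using continuous_map_compose[OF time \<rho>] continuous_map_compose[OF time \<rho>']
    by (auto simp: continuous_map_into_unit_interval o_def)
  have "continuous_map (prod_topology unit_interval ?C) X
      (\<lambda>z. f ((1 - fst z) * \<rho> (fst (snd z)) + fst z * \<rho>' (fst (snd z)), snd (snd z)))"
  proof (rule continuous_map_apply_pair[OF f])
    show "continuous_map (prod_topology unit_interval ?C) unit_interval
        (\<lambda>z. (1 - fst z) * \<rho> (fst (snd z)) + fst z * \<rho>' (fst (snd z)))"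
      unfolding continuous_map_into_unit_interval
      using range by (auto intro!: continuous_intros re)
    show "continuous_map (prod_topology unit_interval ?C) S (\<lambda>z. snd (snd z))"
      using continuous_map_compose[OF continuous_map_snd continuous_map_snd] by (simp add: o_def)
  qed
  moreover have "P (\<lambda>z. ?H (u, z))" if "u \<in> {0..1}" for u
  proof -
    have "P (\<lambda>(t, s). f ((1 - u) * \<rho> t + u * \<rho>' t, s))"
      by (rule P) (use range that ends in \<open>auto simp: algebra_simps\<close>)
    then show ?thesis by simp
  qed
  ultimately show ?thesis
    unfolding homotopic_with_def
    by (intro exI[of _ ?H]) (auto simp: case_prod_unfold)
qed

definition homotopy_class ::
    "(('a \<Rightarrow> 'b) \<Rightarrow> bool) \<Rightarrow> 'a topology \<Rightarrow> 'b topology \<Rightarrow> ('a \<Rightarrow> 'b) \<Rightarrow> ('a \<Rightarrow> 'b) set" where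
  "homotopy_class P X Y f = {f'. homotopic_with P X Y f f'}"

lemma homotopy_class_eq:
  "homotopic_with P X Y f f' \<Longrightarrow> homotopy_class P X Y f = homotopy_class P X Y f'"
  unfolding homotopy_class_def by (blast intro: homotopic_with_trans homotopic_with_symD)

lemma homotopy_class_eqD:
  assumes "homotopy_class P X Y f = homotopy_class P X Y f'" "continuous_map X Y f'" "P f'"
  shows "homotopic_with P X Y f f'"
  using assms unfolding homotopy_class_def by (auto simp: set_eq_iff)

text \<open>The form in which operations on classes, defined as unions over representatives, are evaluated.\<close>

lemma UN_homotopy_class:
  assumes "continuous_map X Y f0" "P f0"
    and "\<And>f. homotopic_with P X Y f0 f \<Longrightarrow> homotopic_with Q X' Y' (F f0) (F f)"
  shows "(\<Union>f\<in>homotopy_class P X Y f0. homotopy_class Q X' Y' (F f))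
           = homotopy_class Q X' Y' (F f0)"
proof -
  have "f0 \<in> homotopy_class P X Y f0"
    using assms by (simp add: homotopy_class_def)
  moreover have "homotopy_class Q X' Y' (F f) = homotopy_class Q X' Y' (F f0)"
    if "f \<in> homotopy_class P X Y f0" for f
    using homotopy_class_eq[OF assms(3)[of f]] that by (simp add: homotopy_class_def)
  ultimately show ?thesis by blast
qed

lemma loop_class_eq_homotopy_class:
  "loop_class Z z0 p = homotopy_class (based_loop z0) unit_interval Z p"
  by (simp add: loop_class_def homotopy_class_def)

lemma rhodes_class_eq_homotopy_class:
  "rhodes_class n X x0 \<phi> f g = (homotopy_class (of_order n \<phi> x0 g) (cyl n) X f, g)"
  by (simp add: rhodes_class_def homotopy_class_def)


section \<open>Rhodes groups and their induced homomorphisms\<close>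

lemma rhodes_class_eqI:
  "homotopic_with (of_order n \<phi> x0 g) (cyl n) X f f' \<Longrightarrow>
     rhodes_class n X x0 \<phi> f g = rhodes_class n X x0 \<phi> f' g"
  by (simp add: rhodes_class_eq_homotopy_class homotopy_class_eq)

locale pointed_G_space =
  fixes G :: "('g, 'm) monoid_scheme"
    and X :: "'x topology"
    and x0 :: 'x
    and \<phi> :: "'g \<Rightarrow> 'x \<Rightarrow> 'x"
  assumes group_G: "group G"
    and G_space: "G_space G \<phi> X"
    and x0: "x0 \<in> topspace X"
begin

lemma action: "group_action G (topspace X) \<phi>"
  using G_space by (simp add: G_space_def)

lemma act_continuous:
  assumes "g \<in> carrier G"
  shows "continuous_map X X (\<phi> g)"
proof -
  have "continuous_map X X (\<lambda>x. (\<lambda>(g, x). \<phi> g x) (g, x))"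
    by (rule continuous_map_apply_pair[of "discrete_topology (carrier G)" X])
      (use G_space assms in \<open>auto simp: G_space_def\<close>)
  then show ?thesis by simp
qed

lemma act_one: "x \<in> topspace X \<Longrightarrow> \<phi> \<one>\<^bsub>G\<^esub> x = x"
  using group_action.id_eq_one[OF action] by (metis restrict_apply')

lemma act_mult:
  "g \<in> carrier G \<Longrightarrow> h \<in> carrier G \<Longrightarrow> x \<in> topspace X \<Longrightarrow> \<phi> (g \<otimes>\<^bsub>G\<^esub> h) x = \<phi> g (\<phi> h x)"
  using group_action.composition_rule[OF action] by blast

definition order_map :: "nat \<Rightarrow> 'g \<Rightarrow> (real \<times> (nat \<Rightarrow> real set) \<Rightarrow> 'x) \<Rightarrow> bool" where
  "order_map n g f \<longleftrightarrow> g \<in> carrier G \<and> continuous_map (cyl n) X f \<and> of_order n \<phi> x0 g f"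

abbreviation "product_map g' f' f \<equiv> concat_cyl f' (\<lambda>u. \<phi> g' (f u))"

lemma in_carrier_rhodes_group:
  "x \<in> carrier (rhodes_group n X x0 G \<phi>) \<longleftrightarrow>
     (\<exists>f g. order_map n g f \<and> x = rhodes_class n X x0 \<phi> f g)"
  unfolding rhodes_group_def order_map_def by auto

lemma rhodes_class_in_carrier:
  "order_map n g f \<Longrightarrow> rhodes_class n X x0 \<phi> f g \<in> carrier (rhodes_group n X x0 G \<phi>)"
  unfolding in_carrier_rhodes_group by (intro exI conjI) auto

lemma order_map_in_topspace:
  "order_map n g f \<Longrightarrow> z \<in> topspace (cyl n) \<Longrightarrow> f z \<in> topspace X"
  unfolding order_map_def using continuous_map_image_subset_topspace by blast

lemma homotopic_product:
  assumes g: "g' \<in> carrier G" "g \<in> carrier G"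
    and f': "homotopic_with (of_order n \<phi> x0 g') (cyl n) X f' f1'"
    and f: "homotopic_with (of_order n \<phi> x0 g) (cyl n) X f f1"
  shows "homotopic_with (of_order n \<phi> x0 (g' \<otimes>\<^bsub>G\<^esub> g)) (cyl n) X
           (product_map g' f' f) (product_map g' f1' f1)"
  unfolding cyl_def
proof (rule homotopic_concat_cyl)
  let ?Q = "\<lambda>k. \<forall>s\<in>topspace (torus (n - 1)).
      k (0, s) = \<phi> g' x0 \<and> k (1, s) = \<phi> (g' \<otimes>\<^bsub>G\<^esub> g) x0"
  show "homotopic_with (of_order n \<phi> x0 g') (prod_topology unit_interval (torus (n - 1))) X f' f1'"
    using f' by (simp add: cyl_def)
  have "homotopic_with ?Q (cyl n) X (\<phi> g' \<circ> f) (\<phi> g' \<circ> f1)"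
    by (rule homotopic_with_compose_continuous_map_left[OF f act_continuous[OF g(1)]])
      (use g x0 in \<open>auto simp: of_order_def act_mult\<close>)
  then show "homotopic_with ?Q (prod_topology unit_interval (torus (n - 1))) X
      (\<lambda>u. \<phi> g' (f u)) (\<lambda>u. \<phi> g' (f1 u))"
    by (simp add: cyl_def o_def)
qed (auto simp: of_order_def concat_cyl_def concat_path_def)

lemma order_map_homotopic:
  "order_map n g f \<Longrightarrow> homotopic_with (of_order n \<phi> x0 g) (cyl n) X f f"
  by (simp add: order_map_def)

lemma homotopic_imp_order_map:
  "homotopic_with (of_order n \<phi> x0 g) (cyl n) X f f' \<Longrightarrow> g \<in> carrier G \<Longrightarrow> order_map n g f'"
  unfolding order_map_def
  using homotopic_with_imp_continuous_maps homotopic_with_imp_property by blast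

lemma order_map_product:
  assumes "order_map n g' f'" "order_map n g f"
  shows "order_map n (g' \<otimes>\<^bsub>G\<^esub> g) (product_map g' f' f)"
proof (rule homotopic_imp_order_map)
  show "homotopic_with (of_order n \<phi> x0 (g' \<otimes>\<^bsub>G\<^esub> g)) (cyl n) X
      (product_map g' f' f) (product_map g' f' f)"
    using assms by (intro homotopic_product order_map_homotopic) (auto simp: order_map_def)
  show "g' \<otimes>\<^bsub>G\<^esub> g \<in> carrier G"
    using assms group_G by (simp add: order_map_def group.is_monoid monoid.m_closed)
qed

lemma rhodes_mult:
  assumes f': "order_map n g' f'" and f: "order_map n g f"
  shows "rhodes_class n X x0 \<phi> f' g' \<otimes>\<^bsub>rhodes_group n X x0 G \<phi>\<^esub> rhodes_class n X x0 \<phi> f g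
           = rhodes_class n X x0 \<phi> (product_map g' f' f) (g' \<otimes>\<^bsub>G\<^esub> g)"
proof -
  let ?P = "\<lambda>g. of_order n \<phi> x0 g" and ?g = "g' \<otimes>\<^bsub>G\<^esub> g"
  have g: "g' \<in> carrier G" "g \<in> carrier G"
    using assms by (auto simp: order_map_def)
  have inner: "(\<Union>k\<in>homotopy_class (?P g) (cyl n) X f.
        homotopy_class (?P ?g) (cyl n) X (product_map g' k' k))
      = homotopy_class (?P ?g) (cyl n) X (product_map g' k' f)"
    if "order_map n g' k'" for k'
    by (rule UN_homotopy_class)
      (use f that g in \<open>auto simp: order_map_def intro!: homotopic_product\<close>)
  have "(\<Union>k'\<in>homotopy_class (?P g') (cyl n) X f'. \<Union>k\<in>homotopy_class (?P g) (cyl n) X f.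
        homotopy_class (?P ?g) (cyl n) X (product_map g' k' k))
      = (\<Union>k'\<in>homotopy_class (?P g') (cyl n) X f'.
          homotopy_class (?P ?g) (cyl n) X (product_map g' k' f))"
    using homotopic_imp_order_map g inner
    by (intro SUP_cong refl inner) (auto simp: homotopy_class_def)
  also have "\<dots> = homotopy_class (?P ?g) (cyl n) X (product_map g' f' f)"
    by (rule UN_homotopy_class)
      (use f f' g in \<open>auto simp: order_map_def intro!: homotopic_product\<close>)
  finally show ?thesis
    by (simp add: rhodes_group_def rhodes_class_eq_homotopy_class)
qed

lemma rhodes_one: "\<one>\<^bsub>rhodes_group n X x0 G \<phi>\<^esub> = rhodes_class n X x0 \<phi> (\<lambda>_. x0) \<one>\<^bsub>G\<^esub>"
  by (simp add: rhodes_group_def)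

lemma order_map_const: "order_map n \<one>\<^bsub>G\<^esub> (\<lambda>_. x0)"
  using x0 group_G
  by (simp add: order_map_def of_order_def act_one group.is_monoid monoid.one_closed)

text \<open>The order condition is placed on the reparametrized maps rather than on \<open>k\<close> so that the lemma
  covers inverses, where both reparametrizations start and end at the final point of \<open>k\<close>.\<close>

lemma rhodes_class_reparametrize:
  assumes k: "continuous_map (cyl n) X k"
    and \<rho>: "continuous_map unit_interval unit_interval \<rho>"
    and \<rho>': "continuous_map unit_interval unit_interval \<rho>'"
    and ends: "\<rho>' 0 = \<rho> 0" "\<rho>' 1 = \<rho> 1"
    and f: "order_map n g f" and f': "order_map n g f'"
    and eq: "\<And>t s. t \<in> {0..1} \<Longrightarrow> s \<in> topspace (torus (n - 1)) \<Longrightarrow> f (t, s) = k (\<rho> t, s)"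
      "\<And>t s. t \<in> {0..1} \<Longrightarrow> s \<in> topspace (torus (n - 1)) \<Longrightarrow> f' (t, s) = k (\<rho>' t, s)"
  shows "rhodes_class n X x0 \<phi> f g = rhodes_class n X x0 \<phi> f' g"
proof (rule rhodes_class_eqI)
  let ?P = "of_order n \<phi> x0 g"
  have P: "?P (\<lambda>(t, s). k (\<tau> t, s))" if "\<tau> 0 = \<rho> 0" "\<tau> 1 = \<rho> 1" for \<tau> :: "real \<Rightarrow> real"
    using f eq(1)[of 0] eq(1)[of 1] that by (auto simp: order_map_def of_order_def)
  have "homotopic_with ?P (cyl n) X f (\<lambda>(t, s). k (\<rho> t, s))"
    by (rule homotopic_with_equal)
      (use f P eq in \<open>auto simp: order_map_def cyl_def\<close>)
  moreover have "homotopic_with ?P (cyl n) X (\<lambda>(t, s). k (\<rho> t, s)) (\<lambda>(t, s). k (\<rho>' t, s))"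
    unfolding cyl_def
    by (rule homotopic_reparametrize) (use k \<rho> \<rho>' ends P in \<open>auto simp: cyl_def\<close>)
  moreover have "homotopic_with ?P (cyl n) X f' (\<lambda>(t, s). k (\<rho>' t, s))"
    by (rule homotopic_with_equal)
      (use f' P eq ends in \<open>auto simp: order_map_def cyl_def\<close>)
  ultimately show "homotopic_with ?P (cyl n) X f f'"
    by (meson homotopic_with_trans homotopic_with_symD)
qed

lemma rhodes_assoc:
  assumes f1: "order_map n g1 f1" and f2: "order_map n g2 f2" and f3: "order_map n g3 f3"
  shows "rhodes_class n X x0 \<phi> (product_map (g1 \<otimes>\<^bsub>G\<^esub> g2) (product_map g1 f1 f2) f3)
             (g1 \<otimes>\<^bsub>G\<^esub> g2 \<otimes>\<^bsub>G\<^esub> g3)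
         = rhodes_class n X x0 \<phi> (product_map g1 f1 (product_map g2 f2 f3))
             (g1 \<otimes>\<^bsub>G\<^esub> (g2 \<otimes>\<^bsub>G\<^esub> g3))"
    (is "rhodes_class n X x0 \<phi> ?l ?g = rhodes_class n X x0 \<phi> ?r ?g'")
proof -
  interpret group G by (rule group_G)
  have g: "g1 \<in> carrier G" "g2 \<in> carrier G" "g3 \<in> carrier G"
    using assms by (auto simp: order_map_def)
  then have g_eq: "?g = ?g'" by (simp add: m_assoc)
  have l: "order_map n ?g ?l" and r: "order_map n ?g' ?r"
    using assms by (auto intro!: order_map_product)
  \<comment> \<open>Left-associated concatenation runs through the three pieces on \<open>[0, 1/4]\<close>, \<open>[1/4, 1/2]\<close>,
    \<open>[1/2, 1]\<close>, the right-associated one on \<open>[0, 1/2]\<close>, \<open>[1/2, 3/4]\<close>, \<open>[3/4, 1]\<close>; this concave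
    piecewise linear function matches them.\<close>
  let ?\<theta> = "\<lambda>t::real. min (2 * t) (min (t + 1/4) ((t + 1)/2))"
  have "rhodes_class n X x0 \<phi> ?l ?g' = rhodes_class n X x0 \<phi> ?r ?g'"
  proof (rule rhodes_class_reparametrize)
    show "continuous_map (cyl n) X ?r" using r by (simp add: order_map_def)
    show "continuous_map unit_interval unit_interval ?\<theta>"
      unfolding continuous_map_into_unit_interval
      by (auto simp: min_le_iff_disj intro!: continuous_intros)
    show "continuous_map unit_interval unit_interval (\<lambda>t. t)" by simp
    show "?l (t, s) = ?r (?\<theta> t, s)" if t: "t \<in> {0..1}" and s: "s \<in> topspace (torus (n - 1))" for t s
    proof -
      consider "t \<le> 1/4" | "1/4 < t" "t \<le> 1/2" | "1/2 < t" by linarith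
      then show ?thesis
      proof cases
        case 1
        then have "?\<theta> t = 2 * t" by (auto simp: min_def)
        with 1 show ?thesis by (simp add: concat_cyl_def concat_path_def)
      next
        case 2
        then have "?\<theta> t = t + 1/4" by (auto simp: min_def)
        with 2 show ?thesis by (simp add: concat_cyl_def concat_path_def algebra_simps)
      next
        case 3
        then have \<theta>: "?\<theta> t = (t + 1)/2" by (auto simp: min_def)
        have "(2 * t - 1, s) \<in> topspace (cyl n)"
          using t s 3 by (auto simp: cyl_def)
        then have "f3 (2 * t - 1, s) \<in> topspace X"
          by (rule order_map_in_topspace[OF f3])
        with 3 g show ?thesis
          unfolding \<theta> by (simp add: concat_cyl_def concat_path_def act_mult field_simps)
      qed
    qed
  qed (use l r g_eq in auto)
  then show ?thesis by (simp add: g_eq)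
qed

lemma rhodes_unit:
  assumes f: "order_map n g f"
  shows "rhodes_class n X x0 \<phi> (product_map \<one>\<^bsub>G\<^esub> (\<lambda>_. x0) f) g = rhodes_class n X x0 \<phi> f g"
proof -
  interpret group G by (rule group_G)
  have g: "g \<in> carrier G" using f by (simp add: order_map_def)
  show ?thesis
  proof (rule rhodes_class_reparametrize)
    show "continuous_map (cyl n) X f" using f by (simp add: order_map_def)
    show "continuous_map unit_interval unit_interval (\<lambda>t. max 0 (2 * t - 1))"
      unfolding continuous_map_into_unit_interval
      by (auto intro!: continuous_intros)
    show "continuous_map unit_interval unit_interval (\<lambda>t. t)" by simp
    show "order_map n g (product_map \<one>\<^bsub>G\<^esub> (\<lambda>_. x0) f)"
      using order_map_product[OF order_map_const f] g by simp
    show "product_map \<one>\<^bsub>G\<^esub> (\<lambda>_. x0) f (t, s) = f (max 0 (2 * t - 1), s)"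
      if t: "t \<in> {0..1}" and s: "s \<in> topspace (torus (n - 1))" for t s
    proof (cases "t \<le> 1/2")
      case True
      then have "max 0 (2 * t - 1) = 0" by simp
      with True f s show ?thesis
        by (simp add: concat_cyl_def concat_path_def order_map_def of_order_def)
    next
      case False
      then have "(2 * t - 1, s) \<in> topspace (cyl n)"
        using t s by (auto simp: cyl_def)
      then have "f (2 * t - 1, s) \<in> topspace X"
        by (rule order_map_in_topspace[OF f])
      with False show ?thesis
        by (simp add: concat_cyl_def concat_path_def act_one max_absorb2)
    qed
  qed (use f in auto)
qed

text \<open>The inverse of \<open>f\<close> runs backwards and is translated by the inverse group element so as to start at
  \<open>x0\<close>.\<close>

lemma rhodes_inverse:
  assumes f: "order_map n g f"
  defines "f' \<equiv> \<lambda>(t, s). \<phi> (inv\<^bsub>G\<^esub> g) (f (1 - t, s))"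
  shows "order_map n (inv\<^bsub>G\<^esub> g) f'"
    and "rhodes_class n X x0 \<phi> (product_map (inv\<^bsub>G\<^esub> g) f' f) \<one>\<^bsub>G\<^esub>
           = rhodes_class n X x0 \<phi> (\<lambda>_. x0) \<one>\<^bsub>G\<^esub>"
proof -
  interpret group G by (rule group_G)
  have g: "g \<in> carrier G" "inv\<^bsub>G\<^esub> g \<in> carrier G"
    using f by (auto simp: order_map_def)
  let ?k = "\<lambda>z. \<phi> (inv\<^bsub>G\<^esub> g) (f z)"
  have k: "continuous_map (cyl n) X ?k"
    using continuous_map_compose[OF _ act_continuous[OF g(2)], of "cyl n" f] f
    by (simp add: order_map_def o_def)
  have ends: "?k (0, s) = \<phi> (inv\<^bsub>G\<^esub> g) x0" "?k (1, s) = x0" if "s \<in> topspace (torus (n - 1))" for s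
    using f that x0 act_mult[OF g(2,1) x0]
    by (auto simp: order_map_def of_order_def act_one)
  have "continuous_map (cyl n) X (\<lambda>z. ?k (1 - fst z, snd z))"
    unfolding cyl_def
    by (rule continuous_map_apply_pair[OF k[unfolded cyl_def]])
      (auto simp: continuous_map_into_unit_interval continuous_map_snd intro!: continuous_intros)
  then show f': "order_map n (inv\<^bsub>G\<^esub> g) f'"
    using ends g by (simp add: order_map_def of_order_def f'_def case_prod_unfold)
  show "rhodes_class n X x0 \<phi> (product_map (inv\<^bsub>G\<^esub> g) f' f) \<one>\<^bsub>G\<^esub>
      = rhodes_class n X x0 \<phi> (\<lambda>_. x0) \<one>\<^bsub>G\<^esub>"
  proof (rule rhodes_class_reparametrize[OF k])
    show "continuous_map unit_interval unit_interval (\<lambda>t. \<bar>1 - 2 * t\<bar>)"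
      unfolding continuous_map_into_unit_interval by (auto intro!: continuous_intros)
    show "continuous_map unit_interval unit_interval (\<lambda>t. 1)" by simp
    show "order_map n \<one>\<^bsub>G\<^esub> (product_map (inv\<^bsub>G\<^esub> g) f' f)"
      using order_map_product[OF f' f] g by simp
  qed (use ends order_map_const in \<open>auto simp: f'_def concat_cyl_def concat_path_def abs_if\<close>)
qed

lemma group_rhodes_group: "group (rhodes_group n X x0 G \<phi>)"
proof (rule groupI)
  interpret group G by (rule group_G)
  let ?R = "rhodes_group n X x0 G \<phi>"
  show "\<one>\<^bsub>?R\<^esub> \<in> carrier ?R"
    using order_map_const by (auto simp: in_carrier_rhodes_group rhodes_one)
  show "x \<otimes>\<^bsub>?R\<^esub> y \<in> carrier ?R" if "x \<in> carrier ?R" "y \<in> carrier ?R" for x y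
    using that order_map_product by (fastforce simp: in_carrier_rhodes_group rhodes_mult)
  show "x \<otimes>\<^bsub>?R\<^esub> y \<otimes>\<^bsub>?R\<^esub> z = x \<otimes>\<^bsub>?R\<^esub> (y \<otimes>\<^bsub>?R\<^esub> z)"
    if "x \<in> carrier ?R" "y \<in> carrier ?R" "z \<in> carrier ?R" for x y z
    using that unfolding in_carrier_rhodes_group
    by (elim exE conjE) (simp add: rhodes_mult order_map_product rhodes_assoc)
  show "\<one>\<^bsub>?R\<^esub> \<otimes>\<^bsub>?R\<^esub> x = x" if x: "x \<in> carrier ?R" for x
  proof -
    obtain f g where f: "order_map n g f" and x: "x = rhodes_class n X x0 \<phi> f g"
      using x unfolding in_carrier_rhodes_group by blast
    moreover have "g \<in> carrier G" using f by (simp add: order_map_def)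
    ultimately show ?thesis
      by (simp add: rhodes_one rhodes_mult order_map_const rhodes_unit)
  qed
  show "\<exists>y\<in>carrier ?R. y \<otimes>\<^bsub>?R\<^esub> x = \<one>\<^bsub>?R\<^esub>" if x: "x \<in> carrier ?R" for x
  proof -
    obtain f g where f: "order_map n g f" and x: "x = rhodes_class n X x0 \<phi> f g"
      using x unfolding in_carrier_rhodes_group by blast
    let ?f' = "\<lambda>(t, s). \<phi> (inv\<^bsub>G\<^esub> g) (f (1 - t, s))"
    have "g \<in> carrier G" using f by (simp add: order_map_def)
    then have "rhodes_class n X x0 \<phi> ?f' (inv\<^bsub>G\<^esub> g) \<otimes>\<^bsub>?R\<^esub> x = \<one>\<^bsub>?R\<^esub>"
      using rhodes_inverse[OF f] by (simp add: x rhodes_mult[OF rhodes_inverse(1)[OF f] f] rhodes_one)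
    moreover have "rhodes_class n X x0 \<phi> ?f' (inv\<^bsub>G\<^esub> g) \<in> carrier ?R"
      by (rule rhodes_class_in_carrier[OF rhodes_inverse(1)[OF f]])
    ultimately show ?thesis by (rule bexI)
  qed
qed

definition cyl_map :: "('a \<Rightarrow> 'b) \<Rightarrow> real \<times> 'a \<Rightarrow> real \<times> 'b" where
  "cyl_map \<alpha> = (\<lambda>(t, s). (t, \<alpha> s))"

lemma continuous_cyl_map:
  assumes "continuous_map (torus (k - 1)) (torus (n - 1)) \<alpha>"
  shows "continuous_map (cyl k) (cyl n) (cyl_map \<alpha>)"
  unfolding cyl_def cyl_map_def case_prod_unfold
  by (intro continuous_map_pairedI continuous_map_fst
      continuous_map_compose[OF continuous_map_snd assms, unfolded o_def])

lemma of_order_cyl_map: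
  assumes "continuous_map (torus (k - 1)) (torus (n - 1)) \<alpha>" "of_order n \<phi> x0 g f"
  shows "of_order k \<phi> x0 g (f \<circ> cyl_map \<alpha>)"
  using assms continuous_map_image_subset_topspace[OF assms(1)]
  by (auto simp: of_order_def cyl_map_def)

lemma order_map_cyl_map:
  assumes "continuous_map (torus (k - 1)) (torus (n - 1)) \<alpha>" "order_map n g f"
  shows "order_map k g (f \<circ> cyl_map \<alpha>)"
  using assms of_order_cyl_map[OF assms(1)] continuous_map_compose[OF continuous_cyl_map[OF assms(1)]]
  by (auto simp: order_map_def)

lemma rhodes_induced_class:
  assumes \<alpha>: "continuous_map (torus (k - 1)) (torus (n - 1)) \<alpha>" and f: "order_map n g f"
  shows "rhodes_induced k X x0 \<phi> (cyl_map \<alpha>) (rhodes_class n X x0 \<phi> f g)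
           = rhodes_class k X x0 \<phi> (f \<circ> cyl_map \<alpha>) g"
proof -
  have "(\<Union>f\<in>homotopy_class (of_order n \<phi> x0 g) (cyl n) X f.
        homotopy_class (of_order k \<phi> x0 g) (cyl k) X (f \<circ> cyl_map \<alpha>))
      = homotopy_class (of_order k \<phi> x0 g) (cyl k) X (f \<circ> cyl_map \<alpha>)"
    by (rule UN_homotopy_class)
      (use f of_order_cyl_map[OF \<alpha>] in \<open>auto simp: order_map_def
        intro: homotopic_with_compose_continuous_map_right continuous_cyl_map[OF \<alpha>]\<close>)
  then show ?thesis
    by (simp add: rhodes_induced_def rhodes_class_eq_homotopy_class)
qed

lemma rhodes_induced_hom:
  assumes \<alpha>: "continuous_map (torus (k - 1)) (torus (n - 1)) \<alpha>"
  shows "group_hom (rhodes_group n X x0 G \<phi>) (rhodes_group k X x0 G \<phi>)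
           (rhodes_induced k X x0 \<phi> (cyl_map \<alpha>))"
proof (intro group_hom.intro group_hom_axioms.intro group_rhodes_group homI)
  fix x assume "x \<in> carrier (rhodes_group n X x0 G \<phi>)"
  then obtain f g where f: "order_map n g f" and x: "x = rhodes_class n X x0 \<phi> f g"
    unfolding in_carrier_rhodes_group by blast
  show "rhodes_induced k X x0 \<phi> (cyl_map \<alpha>) x \<in> carrier (rhodes_group k X x0 G \<phi>)"
    unfolding x rhodes_induced_class[OF \<alpha> f]
    by (rule rhodes_class_in_carrier[OF order_map_cyl_map[OF \<alpha> f]])
next
  fix x y assume "x \<in> carrier (rhodes_group n X x0 G \<phi>)" "y \<in> carrier (rhodes_group n X x0 G \<phi>)"
  then obtain f' g' f g where f': "order_map n g' f'" and f: "order_map n g f"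
    and xy: "x = rhodes_class n X x0 \<phi> f' g'" "y = rhodes_class n X x0 \<phi> f g"
    unfolding in_carrier_rhodes_group by blast
  have "product_map g' f' f \<circ> cyl_map \<alpha> = product_map g' (f' \<circ> cyl_map \<alpha>) (f \<circ> cyl_map \<alpha>)"
    by (auto simp: concat_cyl_def concat_path_def cyl_map_def)
  then show "rhodes_induced k X x0 \<phi> (cyl_map \<alpha>) (x \<otimes>\<^bsub>rhodes_group n X x0 G \<phi>\<^esub> y)
      = rhodes_induced k X x0 \<phi> (cyl_map \<alpha>) x \<otimes>\<^bsub>rhodes_group k X x0 G \<phi>\<^esub>
        rhodes_induced k X x0 \<phi> (cyl_map \<alpha>) y"
    using order_map_product[OF f' f] order_map_cyl_map[OF \<alpha>] f f'
    by (simp add: xy rhodes_mult rhodes_induced_class[OF \<alpha>])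
qed

end


section \<open>The circle, tori and mapping spaces\<close>

lemma topspace_circle_top: "topspace circle_top = circle_class ` {0..1}"
  by (simp add: circle_top_def)

lemma quotient_map_circle_class: "quotient_map unit_interval circle_top circle_class"
  unfolding circle_top_def by (rule quotient_map_quotient_topology)

lemma continuous_map_circle_class: "continuous_map unit_interval circle_top circle_class"
  by (rule quotient_imp_continuous_map[OF quotient_map_circle_class])

lemma compact_unit_interval: "compact_space unit_interval"
  by (simp add: compact_space_subtopology)

lemma Hausdorff_unit_interval: "Hausdorff_space unit_interval"
  by (simp add: Hausdorff_space_subtopology)

lemma square_compact_Hausdorff:
  "compact_space (prod_topology unit_interval unit_interval)"
  "Hausdorff_space (prod_topology unit_interval unit_interval)"
  by (simp_all only: compact_space_prod_topology Hausdorff_space_prod_topology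
      compact_unit_interval Hausdorff_unit_interval simp_thms)

lemma compact_circle_top: "compact_space circle_top"
  using image_compactin[OF _ continuous_map_circle_class, of "topspace unit_interval"]
    compact_unit_interval
  by (simp add: compact_space_def topspace_circle_top)

definition circle_rep :: "real set \<Rightarrow> real" where
  "circle_rep c = (SOME u. u \<in> c)"

lemma circle_rep_cases:
  assumes "u \<in> {0..1}"
  shows "circle_rep (circle_class u) = u \<or> (u \<in> {0, 1} \<and> circle_rep (circle_class u) \<in> {0, 1})"
proof -
  have "circle_rep (circle_class u) \<in> circle_class u"
    unfolding circle_rep_def by (rule someI[of _ u]) (simp add: circle_class_def)
  then show ?thesis
    by (auto simp: circle_class_def split: if_splits)
qed

lemma circle_class_rep: "c \<in> topspace circle_top \<Longrightarrow> circle_class (circle_rep c) = c"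
proof -
  assume "c \<in> topspace circle_top"
  then obtain u where u: "u \<in> {0..1}" and c: "c = circle_class u"
    by (auto simp: topspace_circle_top)
  have end_points: "circle_class v = {0, 1}" if "v \<in> {0, 1}" for v
    using that by (simp add: circle_class_def)
  show ?thesis
  proof (cases "circle_rep c = u")
    case False
    then have "u \<in> {0, 1}" "circle_rep c \<in> {0, 1}"
      using circle_rep_cases[OF u] by (simp_all add: c)
    then show ?thesis by (simp only: c end_points)
  qed (simp add: c)
qed

lemma circle_rep_in_unit_interval: "c \<in> topspace circle_top \<Longrightarrow> circle_rep c \<in> {0..1}"
proof -
  assume "c \<in> topspace circle_top"
  then obtain u where u: "u \<in> {0..1}" and c: "c = circle_class u"
    by (auto simp: topspace_circle_top)
  show ?thesis using circle_rep_cases[OF u] u by (auto simp: c)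
qed

text \<open>At the identified point the representative may be \<open>0\<close> or \<open>1\<close>; functions that agree there do not
  see the choice.\<close>

lemma apply_circle_rep:
  assumes "u \<in> {0..1}" "F 0 = F 1"
  shows "F (circle_rep (circle_class u)) = F u"
  using circle_rep_cases[OF assms(1)] assms(2) by auto

text \<open>The polynomial curve \<open>t \<mapsto> (t (1 - t), t\<^sup>2 (1 - t))\<close> takes the same value at \<open>0\<close> and \<open>1\<close> and is
  otherwise injective on \<open>[0, 1]\<close>: off the end points, \<open>t\<close> is the quotient of the two components.\<close>

lemma Hausdorff_circle_top: "Hausdorff_space circle_top"
proof (rule Hausdorff_space_injective_preimage)
  let ?c = "\<lambda>t::real. (t * (1 - t), t * (t * (1 - t)))"
  let ?f = "\<lambda>c. ?c (circle_rep c)"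
  show "Hausdorff_space (prod_topology euclideanreal euclideanreal)"
    by (simp add: Hausdorff_space_prod_topology)
  have f: "?f (circle_class u) = ?c u" if "u \<in> {0..1}" for u
    by (rule apply_circle_rep[OF that, of ?c]) simp
  have "continuous_map unit_interval (prod_topology euclideanreal euclideanreal) ?c"
    by (intro continuous_map_pairedI continuous_intros continuous_map_from_subtopology) auto
  then have "continuous_map unit_interval (prod_topology euclideanreal euclideanreal)
      (?f \<circ> circle_class)"
    by (rule continuous_map_eq) (simp only: o_apply f topspace_euclidean_subtopology)
  then show "continuous_map circle_top (prod_topology euclideanreal euclideanreal) ?f"
    by (rule continuous_compose_quotient_map[OF quotient_map_circle_class])
  show "inj_on ?f (topspace circle_top)"
  proof (rule inj_onI)
    fix c d assume c: "c \<in> topspace circle_top" and d: "d \<in> topspace circle_top" and eq: "?f c = ?f d"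
    have "circle_class (circle_rep c) = circle_class (circle_rep d)"
    proof (cases "circle_rep c * (1 - circle_rep c) = 0")
      case True
      with eq have "circle_rep c \<in> {0, 1}" "circle_rep d \<in> {0, 1}" by auto
      then show ?thesis by (auto simp: circle_class_def)
    next
      case False
      with eq show ?thesis by (auto simp: mult_right_cancel)
    qed
    then show "c = d" by (simp add: circle_class_rep c d)
  qed
qed

lemma compact_torus: "compact_space (torus m)"
  by (simp add: torus_def compact_space_product_topology compact_circle_top)

lemma Hausdorff_torus: "Hausdorff_space (torus m)"
  by (simp add: torus_def Hausdorff_space_product_topology Hausdorff_circle_top)

lemma topspace_torus: "topspace (torus m) = (\<Pi>\<^sub>E i\<in>{2..Suc m}. topspace circle_top)"
  by (simp add: torus_def)

lemma in_torus_coord: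
  "s \<in> topspace (torus m) \<Longrightarrow> i \<in> {2..Suc m} \<Longrightarrow> s i \<in> topspace circle_top"
  by (auto simp: topspace_torus)

lemma fun_upd_in_torus:
  "s \<in> topspace (torus m) \<Longrightarrow> c \<in> topspace circle_top \<Longrightarrow>
     s(Suc (Suc m) := c) \<in> topspace (torus (Suc m))"
  by (auto simp: topspace_torus PiE_iff extensional_def)

lemma circle_class_in_circle_top: "u \<in> {0..1} \<Longrightarrow> circle_class u \<in> topspace circle_top"
  by (simp add: topspace_circle_top)

lemma restrict_in_torus:
  "s \<in> topspace (torus (Suc m)) \<Longrightarrow> restrict s {2..Suc m} \<in> topspace (torus m)"
  by (auto simp: topspace_torus PiE_iff)

lemma fun_upd_restrict_torus:
  assumes "s \<in> topspace (torus (Suc m))"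
  shows "(restrict s {2..Suc m})(Suc (Suc m) := s (Suc (Suc m))) = s"
  using assms by (auto simp: topspace_torus PiE_iff extensional_def fun_eq_iff)

lemma restrict_torus:
  "s \<in> topspace (torus m) \<Longrightarrow> restrict s {2..Suc m} = s"
  by (simp add: topspace_torus PiE_restrict)

lemma restrict_fun_upd_torus:
  "s \<in> topspace (torus m) \<Longrightarrow> restrict (s(Suc (Suc m) := c)) {2..Suc m} = s"
  by (simp add: restrict_torus)

lemma continuous_map_torus_fun_upd:
  assumes a: "continuous_map A (torus m) a" and c: "continuous_map A circle_top c"
  shows "continuous_map A (torus (Suc m)) (\<lambda>x. (a x)(Suc (Suc m) := c x))"
proof -
  have "continuous_map A circle_top (\<lambda>x. ((a x)(Suc (Suc m) := c x)) k)" if "k \<in> {2..Suc (Suc m)}" for k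
    using that a c by (cases "k = Suc (Suc m)") (auto simp: torus_def continuous_map_componentwise)
  moreover have "(\<lambda>x. (a x)(Suc (Suc m) := c x)) ` topspace A \<subseteq> extensional {2..Suc (Suc m)}"
    using continuous_map_image_subset_topspace[OF a] by (force simp: topspace_torus PiE_iff extensional_def)
  ultimately show ?thesis
    by (auto simp: torus_def continuous_map_componentwise)
qed

lemma continuous_map_torus_restrict:
  "continuous_map (torus (Suc m)) (torus m) (\<lambda>s. restrict s {2..Suc m})"
  unfolding torus_def continuous_map_componentwise
  by (auto intro!: continuous_map_product_projection)

text \<open>Identifying the end points of the last coordinate of \<open>Y \<times> T\<^sup>m \<times> I\<close> is a quotient map onto
  \<open>Y \<times> T\<^sup>m\<^sup>+\<^sup>1\<close>, being a continuous surjection from a compact space to a Hausdorff space.\<close>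

lemma continuous_map_from_torus:
  assumes Y: "compact_space Y" "Hausdorff_space Y"
    and F: "continuous_map (prod_topology (prod_topology Y (torus m)) unit_interval) X F"
    and eq: "\<And>y s. y \<in> topspace Y \<Longrightarrow> s \<in> topspace (torus m) \<Longrightarrow> F ((y, s), 0) = F ((y, s), 1)"
  shows "continuous_map (prod_topology Y (torus (Suc m))) X
           (\<lambda>(y, s). F ((y, restrict s {2..Suc m}), circle_rep (s (Suc (Suc m)))))"
proof (rule continuous_compose_quotient_map)
  let ?A = "prod_topology (prod_topology Y (torus m)) unit_interval"
  let ?q = "\<lambda>z. (fst (fst z), (snd (fst z))(Suc (Suc m) := circle_class (snd z)))"
  show "quotient_map ?A (prod_topology Y (torus (Suc m))) ?q"
  proof (rule continuous_imp_quotient_map)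
    show "continuous_map ?A (prod_topology Y (torus (Suc m))) ?q"
      by (intro continuous_map_pairedI continuous_map_torus_fun_upd
          continuous_map_compose[OF continuous_map_fst continuous_map_fst, unfolded o_def]
          continuous_map_compose[OF continuous_map_fst continuous_map_snd, unfolded o_def]
          continuous_map_compose[OF continuous_map_snd continuous_map_circle_class, unfolded o_def])
    show "compact_space ?A"
      using Y compact_torus compact_unit_interval by (simp add: compact_space_prod_topology)
    show "Hausdorff_space (prod_topology Y (torus (Suc m)))"
      using Y Hausdorff_torus by (simp add: Hausdorff_space_prod_topology)
    show "?q ` topspace ?A = topspace (prod_topology Y (torus (Suc m)))"
    proof (intro equalityI subsetI)
      fix z assume "z \<in> topspace (prod_topology Y (torus (Suc m)))"
      then obtain y s where z: "z = (y, s)" "y \<in> topspace Y" and s: "s \<in> topspace (torus (Suc m))"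
        by auto
      have "s (Suc (Suc m)) \<in> topspace circle_top" using in_torus_coord[OF s] by simp
      then have "z = ?q ((y, restrict s {2..Suc m}), circle_rep (s (Suc (Suc m))))"
        "circle_rep (s (Suc (Suc m))) \<in> {0..1}"
        using z fun_upd_restrict_torus[OF s] circle_rep_in_unit_interval by (auto simp: circle_class_rep)
      moreover from this(2) have "((y, restrict s {2..Suc m}), circle_rep (s (Suc (Suc m)))) \<in> topspace ?A"
        using z restrict_in_torus[OF s] by simp
      ultimately show "z \<in> ?q ` topspace ?A" by (intro image_eqI)
    next
      fix z assume "z \<in> ?q ` topspace ?A"
      then obtain y s u where "z = ?q ((y, s), u)" "y \<in> topspace Y" "s \<in> topspace (torus m)"
        "u \<in> {0..1}"
        by (elim imageE) (auto simp del: fun_upd_apply)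
      then show "z \<in> topspace (prod_topology Y (torus (Suc m)))"
        using fun_upd_in_torus circle_class_in_circle_top by simp
    qed
  qed
  show "continuous_map ?A X
      ((\<lambda>(y, s). F ((y, restrict s {2..Suc m}), circle_rep (s (Suc (Suc m))))) \<circ> ?q)"
  proof (rule continuous_map_eq[OF F])
    fix z assume "z \<in> topspace ?A"
    then obtain y s u where z: "z = ((y, s), u)" "y \<in> topspace Y" "s \<in> topspace (torus m)" "u \<in> {0..1}"
      by auto
    show "F z = ((\<lambda>(y, s). F ((y, restrict s {2..Suc m}), circle_rep (s (Suc (Suc m))))) \<circ> ?q) z"
      using apply_circle_rep[OF z(4), of "\<lambda>u. F ((y, s), u)"] eq[OF z(2,3)] z(1)
      by (simp add: restrict_fun_upd_torus[OF z(3)])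
  qed
qed

text \<open>A subbasic open set of maps sending a compact set \<open>C\<close> into \<open>U\<close> pulls back to the parameters
  whose slice over \<open>C\<close> avoids a closed set, which is open because the projection along \<open>C\<close> is closed.\<close>

lemma continuous_map_curry:
  assumes F: "continuous_map (prod_topology Y K) Z F"
  shows "continuous_map Y (mapping_space K Z) (\<lambda>y. \<lambda>k\<in>topspace K. F (y, k))"
  unfolding mapping_space_def
proof (rule continuous_on_generated_topo)
  let ?g = "\<lambda>y. \<lambda>k\<in>topspace K. F (y, k)"
  have maps: "?g y \<in> maps K Z" if "y \<in> topspace Y" for y
  proof -
    have "continuous_map K Z (\<lambda>k. F (y, k))"
      by (rule continuous_map_apply_pair[OF F]) (use that in auto)
    then show ?thesis
      by (auto simp: maps_def intro: continuous_map_eq)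
  qed
  then show "?g ` topspace Y \<subseteq> \<Union>{{f \<in> maps K Z. f ` C \<subseteq> U} |C U. compactin K C \<and> openin Z U}"
    by (intro subsetI UnionI[of "{f \<in> maps K Z. f ` {} \<subseteq> {}}"] CollectI exI[of _ "{}"]) auto
  fix W assume "W \<in> {{f \<in> maps K Z. f ` C \<subseteq> U} |C U. compactin K C \<and> openin Z U}"
  then obtain C U where W: "W = {f \<in> maps K Z. f ` C \<subseteq> U}" and C: "compactin K C" and U: "openin Z U"
    by (elim CollectE exE conjE) (rule that)
  have CK: "C \<subseteq> topspace K" by (rule compactin_subset_topspace[OF C])
  let ?KC = "subtopology K C"
  define B where "B = {z \<in> topspace (prod_topology Y ?KC). F z \<in> topspace Z - U}"
  have cont: "continuous_map (prod_topology Y ?KC) Z F"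
    using continuous_map_apply_pair[OF F, of "prod_topology Y ?KC" fst snd]
      continuous_map_fst[of Y ?KC] continuous_map_snd[of Y ?KC]
    by (auto simp: continuous_map_in_subtopology)
  then have "closedin (prod_topology Y ?KC) B"
    unfolding B_def by (rule closedin_continuous_map_preimage) (use U in auto)
  moreover have "closed_map (prod_topology Y ?KC) Y fst"
    using C by (intro closed_map_fst) (simp add: compact_space_subtopology)
  ultimately have "closedin Y (fst ` B)"
    by (simp add: closed_map_def)
  then have "openin Y (topspace Y - fst ` B)" by (rule openin_diff[OF openin_topspace])
  moreover have "topspace Y - fst ` B = ?g -` W \<inter> topspace Y"
  proof (intro equalityI subsetI)
    fix y assume y: "y \<in> topspace Y - fst ` B"
    have "F (y, k) \<in> U" if "k \<in> C" for k
    proof (rule ccontr)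
      assume "F (y, k) \<notin> U"
      moreover have "(y, k) \<in> topspace (prod_topology Y ?KC)" using y that CK by auto
      moreover from this have "F (y, k) \<in> topspace Z"
        using cont continuous_map_image_subset_topspace by blast
      ultimately have "(y, k) \<in> B" by (simp add: B_def)
      then show False using y by (metis DiffD2 fst_conv image_eqI)
    qed
    with y maps CK show "y \<in> ?g -` W \<inter> topspace Y" by (auto simp: W)
  next
    fix y assume y: "y \<in> ?g -` W \<inter> topspace Y"
    have "F (y, k) \<in> U" if "k \<in> C" for k
    proof -
      have "?g y ` C \<subseteq> U" using y by (simp add: W)
      then have "?g y k \<in> U" using that by blast
      then show ?thesis using that CK by (simp add: subset_iff)
    qed
    with y show "y \<in> topspace Y - fst ` B" by (auto simp: B_def)
  qed
  ultimately show "openin Y (?g -` W \<inter> topspace Y)" by simp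
qed

text \<open>Evaluation is continuous since a point of \<open>K\<close> has arbitrarily small compact neighbourhoods \<open>C\<close>, and
  the maps sending \<open>C\<close> into \<open>U\<close> form an open set.\<close>

lemma continuous_map_uncurry:
  assumes K: "compact_space K" "Hausdorff_space K"
    and g: "continuous_map Y (mapping_space K Z) g"
  shows "continuous_map (prod_topology Y K) Z (\<lambda>(y, k). g y k)"
proof -
  have gy: "continuous_map K Z (g y)" if "y \<in> topspace Y" for y
    using continuous_map_image_subset_topspace[OF g] that by (auto simp: maps_def)
  have nbhd: "\<exists>T. openin (prod_topology Y K) T \<and> z \<in> T \<and> T \<subseteq> {z \<in> topspace (prod_topology Y K). (\<lambda>(y, k). g y k) z \<in> U}"
    if U: "openin Z U" and z: "z \<in> {z \<in> topspace (prod_topology Y K). (\<lambda>(y, k). g y k) z \<in> U}" for U z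
  proof -
    obtain y k where yk: "z = (y, k)" "y \<in> topspace Y" "k \<in> topspace K" "g y k \<in> U"
      using z by auto
    have "openin K {k \<in> topspace K. g y k \<in> U}"
      using openin_continuous_map_preimage[OF gy[OF yk(2)] U] .
    moreover have "neighbourhood_base_of (compactin K) K"
      using K compact_imp_locally_compact_space locally_compact_space_neighbourhood_base by blast
    ultimately obtain V C where V: "openin K V" "k \<in> V" "V \<subseteq> C"
      and C: "compactin K C" "C \<subseteq> {k \<in> topspace K. g y k \<in> U}"
      using yk(3,4) unfolding neighbourhood_base_of by (metis (no_types, lifting) mem_Collect_eq)
    let ?N = "{f \<in> maps K Z. f ` C \<subseteq> U}"
    have "openin (mapping_space K Z) ?N"
      unfolding mapping_space_def using C(1) U by (intro topology_generated_by_Basis) blast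
    then have N: "openin Y {y \<in> topspace Y. g y \<in> ?N}"
      using openin_continuous_map_preimage[OF g] by blast
    let ?T = "{y \<in> topspace Y. g y \<in> ?N} \<times> V"
    have "openin (prod_topology Y K) ?T"
      using N V(1) by (simp add: openin_prod_Times_iff)
    moreover have "g y \<in> maps K Z"
      using continuous_map_image_subset_topspace[OF g] yk(2) by auto
    then have "z \<in> ?T" using yk V C by auto
    moreover have "?T \<subseteq> {z \<in> topspace (prod_topology Y K). (\<lambda>(y, k). g y k) z \<in> U}"
      using V C openin_subset[OF V(1)] by (auto simp: image_subset_iff subset_iff)
    ultimately show ?thesis by blast
  qed
  show ?thesis
    unfolding continuous_map_def
  proof (intro conjI allI impI)
    show "(\<lambda>(y, k). g y k) \<in> topspace (prod_topology Y K) \<rightarrow> topspace Z"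
      using continuous_map_image_subset_topspace[OF gy] by auto
    show "openin (prod_topology Y K) {z \<in> topspace (prod_topology Y K). (\<lambda>(y, k). g y k) z \<in> U}"
      if "openin Z U" for U
      by (subst openin_subopen) (use nbhd[OF that] in blast)
  qed
qed


text \<open>Loops parametrized by \<open>Y \<times> T\<^sup>m\<close> are maps on \<open>Y \<times> T\<^sup>m\<^sup>+\<^sup>1\<close>: the loop parameter becomes the
  last torus coordinate. The two lemmas give the two directions of this exponential law.\<close>

lemma continuous_map_loops_uncurry:
  assumes Y: "compact_space Y" "Hausdorff_space Y"
    and p: "continuous_map Y (mapping_space (torus m) (loop_space X x0)) p"
  shows "continuous_map (prod_topology Y (torus (Suc m))) X
           (\<lambda>(y, s). p y (restrict s {2..Suc m}) (circle_rep (s (Suc (Suc m)))))"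
proof -
  have p': "continuous_map (prod_topology Y (torus m)) (loop_space X x0) (\<lambda>(y, s). p y s)"
    by (rule continuous_map_uncurry[OF compact_torus Hausdorff_torus p])
  then have "continuous_map (prod_topology Y (torus m)) (mapping_space unit_interval X) (\<lambda>(y, s). p y s)"
    by (simp add: loop_space_def continuous_map_in_subtopology)
  from continuous_map_uncurry[OF compact_unit_interval Hausdorff_unit_interval this]
  have F: "continuous_map (prod_topology (prod_topology Y (torus m)) unit_interval) X
      (\<lambda>(z, u). (\<lambda>(y, s). p y s) z u)" .
  have "p y s 0 = p y s 1" if "y \<in> topspace Y" "s \<in> topspace (torus m)" for y s
  proof -
    have "p y s \<in> topspace (loop_space X x0)"
      using continuous_map_image_subset_topspace[OF p'] that by auto
    then show ?thesis by (simp add: loop_space_def)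
  qed
  from continuous_map_from_torus[OF Y F] this show ?thesis
    by simp
qed

lemma continuous_map_loops_curry:
  assumes g: "continuous_map (prod_topology Y (torus (Suc m))) X g"
    and base: "\<And>y s. y \<in> topspace Y \<Longrightarrow> s \<in> topspace (torus (Suc m)) \<Longrightarrow>
      s (Suc (Suc m)) = circle_class 0 \<Longrightarrow> g (y, s) = x0"
  shows "continuous_map Y (mapping_space (torus m) (loop_space X x0))
           (\<lambda>y. \<lambda>s\<in>topspace (torus m). \<lambda>u\<in>{0..1}. g (y, s(Suc (Suc m) := circle_class u)))"
proof -
  let ?F = "\<lambda>z. \<lambda>u\<in>{0..1}. g (fst z, (snd z)(Suc (Suc m) := circle_class u))"
  let ?B = "prod_topology (prod_topology Y (torus m)) unit_interval"
  have "continuous_map ?B X (\<lambda>w. g (fst (fst w), (snd (fst w))(Suc (Suc m) := circle_class (snd w))))"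
    by (intro continuous_map_apply_pair[OF g] continuous_map_torus_fun_upd
        continuous_map_compose[OF continuous_map_fst continuous_map_fst, unfolded o_def]
        continuous_map_compose[OF continuous_map_fst continuous_map_snd, unfolded o_def]
        continuous_map_compose[OF continuous_map_snd continuous_map_circle_class, unfolded o_def])
  from continuous_map_curry[OF this]
  have "continuous_map (prod_topology Y (torus m)) (mapping_space unit_interval X) ?F"
    by simp
  moreover have "circle_class 1 = circle_class 0" by (simp add: circle_class_def)
  ultimately have "continuous_map (prod_topology Y (torus m)) (loop_space X x0) ?F"
    unfolding loop_space_def continuous_map_in_subtopology
    using base fun_upd_in_torus circle_class_in_circle_top[of 0] by auto
  from continuous_map_curry[OF this] show ?thesis
    by simp
qed

section \<open>Pushing a homotopy of the base into a collar\<close>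

text \<open>Given a family \<open>E\<close> of closed curves and a homotopy \<open>N\<close> of their base points, extend the curves
  to \<open>[-1, 2]\<close> by running along \<open>N\<close> at both ends; restricting to \<open>[-u, 1 + u]\<close> and rescaling to the
  unit interval gives at time \<open>u\<close> a closed curve at the moved base point.\<close>

definition collar ::
    "('y \<times> real \<Rightarrow> 'x) \<Rightarrow> (real \<times> 'y \<Rightarrow> 'x) \<Rightarrow> real \<Rightarrow> 'y \<Rightarrow> real \<Rightarrow> 'x" where
  "collar E N u y v =
     (let w = (1 + 2 * u) * v - u
      in if w \<le> 0 then N (- w, y) else if w \<le> 1 then E (y, w) else N (w - 1, y))"

lemma collar_time_bounds:
  assumes "u \<in> {0..1}" "v \<in> {0..1::real}"
  shows "- u \<le> (1 + 2 * u) * v - u" "(1 + 2 * u) * v - u \<le> 1 + u"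
proof -
  show "- u \<le> (1 + 2 * u) * v - u" using assms by simp
  have "(1 + 2 * u) * v \<le> (1 + 2 * u) * 1" using assms by (intro mult_left_mono) auto
  then show "(1 + 2 * u) * v - u \<le> 1 + u" by simp
qed

lemma continuous_map_collar:
  assumes E: "continuous_map (prod_topology Y unit_interval) X E"
    and N: "continuous_map (prod_topology unit_interval Y) X N"
    and eq: "\<And>y. y \<in> topspace Y \<Longrightarrow> N (0, y) = E (y, 0)" "\<And>y. y \<in> topspace Y \<Longrightarrow> N (0, y) = E (y, 1)"
    and u: "continuous_map Z unit_interval u" and y: "continuous_map Z Y y"
    and v: "continuous_map Z unit_interval v"
  shows "continuous_map Z X (\<lambda>z. collar E N (u z) (y z) (v z))"
proof -
  let ?w = "\<lambda>z. (1 + 2 * u z) * v z - u z"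
  have uv: "continuous_map Z euclideanreal u" "continuous_map Z euclideanreal v"
    and range: "\<And>z. z \<in> topspace Z \<Longrightarrow> u z \<in> {0..1}" "\<And>z. z \<in> topspace Z \<Longrightarrow> v z \<in> {0..1}"
    using u v by (auto simp: continuous_map_into_unit_interval)
  have w: "continuous_map Z euclideanreal ?w"
    by (intro continuous_intros uv) auto
  have y_in: "y z \<in> topspace Y" if "z \<in> topspace Z" for z
    using continuous_map_image_subset_topspace[OF y] that by blast
  have "continuous_map Z X (\<lambda>z. if ?w z \<le> 0 then N (min 1 (max 0 (- ?w z)), y z)
      else if ?w z \<le> 1 then E (y z, min 1 (max 0 (?w z))) else N (min 1 (max 0 (?w z - 1)), y z))"
  proof (intro continuous_map_if_le)
    show "continuous_map Z X (\<lambda>z. N (min 1 (max 0 (- ?w z)), y z))"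
      by (rule continuous_map_apply_pair[OF N _ y])
        (auto simp: continuous_map_into_unit_interval intro!: continuous_intros uv)
    show "continuous_map Z X (\<lambda>z. E (y z, min 1 (max 0 (?w z))))"
      by (rule continuous_map_apply_pair[OF E y])
        (auto simp: continuous_map_into_unit_interval intro!: continuous_intros uv)
    show "continuous_map Z X (\<lambda>z. N (min 1 (max 0 (?w z - 1)), y z))"
      by (rule continuous_map_apply_pair[OF N _ y])
        (auto simp: continuous_map_into_unit_interval intro!: continuous_intros uv)
  qed (use w y_in eq in auto)
  then show ?thesis
  proof (rule continuous_map_eq)
    fix z assume z: "z \<in> topspace Z"
    have "- 1 \<le> ?w z" "?w z \<le> 2"
      using collar_time_bounds[OF range(1)[OF z] range(2)[OF z]] range(1)[OF z] by auto
    then show "(if ?w z \<le> 0 then N (min 1 (max 0 (- ?w z)), y z)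
        else if ?w z \<le> 1 then E (y z, min 1 (max 0 (?w z))) else N (min 1 (max 0 (?w z - 1)), y z))
        = collar E N (u z) (y z) (v z)"
      unfolding collar_def Let_def by (simp add: min_absorb2 max_absorb2)
  qed
qed

lemma collar_start:
  "v \<in> {0..1} \<Longrightarrow> N (0, y) = E (y, 0) \<Longrightarrow> collar E N 0 y v = E (y, v)"
  by (auto simp: collar_def)

lemma collar_ends:
  assumes "u \<in> {0..1}" "N (0, y) = E (y, 1)"
  shows "collar E N u y 0 = N (u, y)" "collar E N u y 1 = N (u, y)"
  using assms by (auto simp: collar_def Let_def algebra_simps)

lemma collar_const:
  assumes "u \<in> {0..1}" "v \<in> {0..1}"
    and "\<And>v. v \<in> {0..1} \<Longrightarrow> E (y, v) = c" "\<And>u. u \<in> {0..1} \<Longrightarrow> N (u, y) = c"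
  shows "collar E N u y v = c"
proof -
  let ?w = "(1 + 2 * u) * v - u"
  have "- 1 \<le> ?w" "?w \<le> 2"
    using collar_time_bounds[OF assms(1,2)] assms(1) by auto
  then show ?thesis
    unfolding collar_def Let_def using assms(3)[of ?w] assms(4)[of "- ?w"] assms(4)[of "?w - 1"]
    by simp
qed

text \<open>The homotopy extension property for \<open>A \<times> T\<^sup>m \<subseteq> A \<times> T\<^sup>m\<^sup>+\<^sup>1\<close>, with an extension that stays constant
  wherever the data are.\<close>

lemma homotopy_extension_torus:
  assumes A: "compact_space A" "Hausdorff_space A"
    and E: "continuous_map (prod_topology A (torus (Suc m))) X E"
    and N: "continuous_map (prod_topology unit_interval (prod_topology A (torus m))) X N"
    and NE: "\<And>a s. a \<in> topspace A \<Longrightarrow> s \<in> topspace (torus m) \<Longrightarrow>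
      N (0, a, s) = E (a, s(Suc (Suc m) := circle_class 0))"
  obtains D where "continuous_map (prod_topology (prod_topology unit_interval A) (torus (Suc m))) X D"
    and "\<And>a s. a \<in> topspace A \<Longrightarrow> s \<in> topspace (torus (Suc m)) \<Longrightarrow> D ((0, a), s) = E (a, s)"
    and "\<And>u a s. u \<in> {0..1} \<Longrightarrow> a \<in> topspace A \<Longrightarrow> s \<in> topspace (torus (Suc m)) \<Longrightarrow>
      s (Suc (Suc m)) = circle_class 0 \<Longrightarrow> D ((u, a), s) = N (u, a, restrict s {2..Suc m})"
    and "\<And>u a s c. u \<in> {0..1} \<Longrightarrow> s \<in> topspace (torus (Suc m)) \<Longrightarrow>
      \<forall>s\<in>topspace (torus (Suc m)). E (a, s) = c \<Longrightarrow>
      \<forall>u\<in>{0..1}. \<forall>s\<in>topspace (torus m). N (u, a, s) = c \<Longrightarrow> D ((u, a), s) = c"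
proof -
  let ?l = "Suc (Suc m)"
  let ?Y = "prod_topology A (torus m)"
  define E' where "E' = (\<lambda>(z, v). E (fst z, (snd z)(?l := circle_class v)))"
  define D where "D = (\<lambda>((u, a), s). collar E' N u (a, restrict s {2..Suc m}) (circle_rep (s ?l)))"
  have circle: "circle_class 1 = circle_class 0" by (simp add: circle_class_def)
  have E'_cont: "continuous_map (prod_topology ?Y unit_interval) X E'"
    unfolding E'_def case_prod_unfold
    by (intro continuous_map_apply_pair[OF E] continuous_map_torus_fun_upd
        continuous_map_compose[OF continuous_map_fst continuous_map_fst, unfolded o_def]
        continuous_map_compose[OF continuous_map_fst continuous_map_snd, unfolded o_def]
        continuous_map_compose[OF continuous_map_snd continuous_map_circle_class, unfolded o_def])
  have NE': "N (0, z) = E' (z, 0)" "N (0, z) = E' (z, 1)" if "z \<in> topspace ?Y" for z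
    using that NE by (auto simp: E'_def circle)
  have rep: "circle_rep (s ?l) \<in> {0..1}" "circle_class (circle_rep (s ?l)) = s ?l"
    if "s \<in> topspace (torus (Suc m))" for s
    using in_torus_coord[OF that, of ?l] circle_rep_in_unit_interval circle_class_rep by auto
  have E'_rep: "E' ((a, restrict s {2..Suc m}), circle_rep (s ?l)) = E (a, s)"
    if "s \<in> topspace (torus (Suc m))" for a s
    using rep[OF that] fun_upd_restrict_torus[OF that] by (simp add: E'_def)
  show thesis
  proof (rule that)
    let ?Z = "prod_topology (prod_topology (prod_topology unit_interval A) (torus m)) unit_interval"
    let ?F = "\<lambda>z. collar E' N (fst (fst (fst z))) (snd (fst (fst z)), snd (fst z)) (snd z)"
    have "continuous_map ?Z X ?F"
      by (intro continuous_map_collar[OF E'_cont N NE'] continuous_map_pairedI continuous_map_snd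
          continuous_map_fst_of[unfolded o_def] continuous_map_snd_of[unfolded o_def]
          continuous_map_compose[OF continuous_map_fst continuous_map_snd, unfolded o_def]
          continuous_map_compose[OF continuous_map_fst
            continuous_map_compose[OF continuous_map_fst continuous_map_fst], unfolded o_def]
          continuous_map_compose[OF continuous_map_fst
            continuous_map_compose[OF continuous_map_fst continuous_map_snd], unfolded o_def])
    then have "continuous_map (prod_topology (prod_topology unit_interval A) (torus (Suc m))) X
        (\<lambda>(y, s). ?F ((y, restrict s {2..Suc m}), circle_rep (s ?l)))"
      by (rule continuous_map_from_torus[rotated 2])
        (use A compact_unit_interval Hausdorff_unit_interval NE' in
          \<open>auto simp: compact_space_prod_topology Hausdorff_space_prod_topology collar_ends\<close>)
    then show "continuous_map (prod_topology (prod_topology unit_interval A) (torus (Suc m))) X D"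
      by (simp add: D_def case_prod_unfold)
    show "D ((0, a), s) = E (a, s)" if "a \<in> topspace A" "s \<in> topspace (torus (Suc m))" for a s
      unfolding D_def prod.case
      using that NE'(1)[of "(a, restrict s {2..Suc m})"] restrict_in_torus[OF that(2)]
      by (subst collar_start[OF rep(1)[OF that(2)]]) (auto simp: E'_rep)
    show "D ((u, a), s) = N (u, a, restrict s {2..Suc m})"
      if u: "u \<in> {0..1}" and a: "a \<in> topspace A" and s: "s \<in> topspace (torus (Suc m))"
        and base: "s ?l = circle_class 0" for u a s
    proof -
      let ?c = "collar E' N u (a, restrict s {2..Suc m})"
      have "?c 0 = N (u, a, restrict s {2..Suc m})" "?c 1 = N (u, a, restrict s {2..Suc m})"
        using collar_ends[of u N "(a, restrict s {2..Suc m})" E'] u a restrict_in_torus[OF s] NE'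
        by auto
      then show ?thesis
        using apply_circle_rep[of 0 ?c] by (simp add: D_def base)
    qed
    show "D ((u, a), s) = c"
      if u: "u \<in> {0..1}" and s: "s \<in> topspace (torus (Suc m))"
        and const: "\<forall>s\<in>topspace (torus (Suc m)). E (a, s) = c"
          "\<forall>u\<in>{0..1}. \<forall>s\<in>topspace (torus m). N (u, a, s) = c" for u a s c
    proof -
      have "E' ((a, restrict s {2..Suc m}), v) = c" if "v \<in> {0..1}" for v
        unfolding E'_def prod.case fst_conv snd_conv
        by (intro bspec[OF const(1)] fun_upd_in_torus restrict_in_torus circle_class_in_circle_top)
          (use s that in auto)
      then show ?thesis
        unfolding D_def prod.case
        by (intro collar_const) (use u s const(2) rep(1) restrict_in_torus in auto)
    qed
  qed
qed


section \<open>Deforming maps relative to the base of the last coordinate\<close>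

text \<open>The maps on \<open>I \<times> T\<^sup>m\<^sup>+\<^sup>1\<close> that correspond to based loops in the space of maps
  \<open>T\<^sup>m \<rightarrow> \<Omega>X\<close>.\<close>

definition loop_map :: "nat \<Rightarrow> 'x \<Rightarrow> (real \<times> (nat \<Rightarrow> real set) \<Rightarrow> 'x) \<Rightarrow> bool" where
  "loop_map m x0 f \<longleftrightarrow>
     (\<forall>t\<in>{0..1}. \<forall>s\<in>topspace (torus (Suc m)).
        t = 0 \<or> t = 1 \<or> s (Suc (Suc m)) = circle_class 0 \<longrightarrow> f (t, s) = x0)"

lemma loop_map_ends:
  assumes "loop_map m x0 f" "s \<in> topspace (torus (Suc m))"
  shows "f (0, s) = x0" "f (1, s) = x0"
  using assms by (force simp: loop_map_def)+

lemma topspace_cyl: "topspace (cyl n) = {0..1} \<times> topspace (torus (n - 1))"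
  by (simp add: cyl_def)

lemma continuous_map_torus_base:
  "continuous_map (torus m) (torus (Suc m)) (\<lambda>s. s(Suc (Suc m) := circle_class 0))"
  using continuous_map_torus_fun_upd[of "torus m" m "\<lambda>s. s" "\<lambda>_. circle_class 0"]
    circle_class_in_circle_top[of 0] by simp

lemma base_in_torus:
  "s \<in> topspace (torus m) \<Longrightarrow> s(Suc (Suc m) := circle_class 0) \<in> topspace (torus (Suc m))"
  by (rule fun_upd_in_torus) (auto intro: circle_class_in_circle_top)

lemma torus_with_base_coordinate:
  assumes "s \<in> topspace (torus (Suc m))" "s (Suc (Suc m)) = circle_class 0"
  shows "(restrict s {2..Suc m})(Suc (Suc m) := circle_class 0) = s"
  using fun_upd_restrict_torus[OF assms(1)] assms(2) by simp

context pointed_G_space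
begin

lemma loop_map_imp_of_order: "loop_map m x0 f \<Longrightarrow> of_order (Suc (Suc m)) \<phi> x0 \<one>\<^bsub>G\<^esub> f"
  using loop_map_ends by (force simp: of_order_def act_one x0)

lemma of_order_one_iff:
  "of_order n \<phi> x0 \<one>\<^bsub>G\<^esub> f \<longleftrightarrow> (\<forall>s\<in>topspace (torus (n - 1)). f (0, s) = x0 \<and> f (1, s) = x0)"
  by (simp add: of_order_def act_one x0)

text \<open>The null-homotopy \<open>H\<close> of the restriction to \<open>t\<^sub>n = 0\<close> is extended to \<open>C\<^sub>n\<close>. Since \<open>f\<close> and \<open>H\<close> are
  constantly \<open>x0\<close> over \<open>t\<^sub>1 = 0\<close> and over \<open>t\<^sub>1 = 1\<close>, so is the extension, and the order is preserved.\<close>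

lemma deform_to_loop_map:
  assumes f: "order_map (Suc (Suc m)) \<one>\<^bsub>G\<^esub> f"
    and null: "homotopic_with (of_order (Suc m) \<phi> x0 \<one>\<^bsub>G\<^esub>) (cyl (Suc m)) X
      (f \<circ> cyl_map (\<lambda>s. s(Suc (Suc m) := circle_class 0))) (\<lambda>_. x0)"
  obtains f' where "loop_map m x0 f'"
    and "homotopic_with (of_order (Suc (Suc m)) \<phi> x0 \<one>\<^bsub>G\<^esub>) (cyl (Suc (Suc m))) X f f'"
proof -
  let ?l = "Suc (Suc m)" and ?P = "of_order (Suc (Suc m)) \<phi> x0 \<one>\<^bsub>G\<^esub>"
  obtain H where H: "continuous_map (prod_topology unit_interval (prod_topology unit_interval (torus m))) X H"
    and H0: "\<And>z. H (0, z) = (f \<circ> cyl_map (\<lambda>s. s(?l := circle_class 0))) z"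
    and H1: "\<And>z. H (1, z) = x0"
    and H_ends: "\<And>u. u \<in> {0..1} \<Longrightarrow> of_order (Suc m) \<phi> x0 \<one>\<^bsub>G\<^esub> (\<lambda>z. H (u, z))"
    using null unfolding homotopic_with_def cyl_def by auto
  have f_cont: "continuous_map (prod_topology unit_interval (torus (Suc m))) X f"
    and f_ends: "\<And>s. s \<in> topspace (torus (Suc m)) \<Longrightarrow> f (0, s) = x0 \<and> f (1, s) = x0"
    using f by (auto simp: order_map_def cyl_def of_order_one_iff)
  obtain D where D: "continuous_map (prod_topology (prod_topology unit_interval unit_interval) (torus (Suc m))) X D"
    and D0: "\<And>t s. t \<in> topspace unit_interval \<Longrightarrow> s \<in> topspace (torus (Suc m)) \<Longrightarrow> D ((0, t), s) = f (t, s)"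
    and D_base: "\<And>u t s. u \<in> {0..1} \<Longrightarrow> t \<in> topspace unit_interval \<Longrightarrow> s \<in> topspace (torus (Suc m)) \<Longrightarrow>
      s ?l = circle_class 0 \<Longrightarrow> D ((u, t), s) = H (u, t, restrict s {2..Suc m})"
    and D_const: "\<And>u t s c. u \<in> {0..1} \<Longrightarrow> s \<in> topspace (torus (Suc m)) \<Longrightarrow>
      \<forall>s\<in>topspace (torus (Suc m)). f (t, s) = c \<Longrightarrow>
      \<forall>u\<in>{0..1}. \<forall>s\<in>topspace (torus m). H (u, t, s) = c \<Longrightarrow> D ((u, t), s) = c"
    by (rule homotopy_extension_torus[OF compact_unit_interval Hausdorff_unit_interval f_cont H])
      (auto simp: H0 cyl_map_def)
  have D_ends: "?P (\<lambda>(t, s). D ((u, t), s))" if u: "u \<in> {0..1}" for u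
    using H_ends f_ends by (auto simp: of_order_one_iff intro!: D_const[OF u])
  have "homotopic_with ?P (cyl ?l) X f (\<lambda>(t, s). D ((0, t), s))"
    using f D0 D_ends[of 0]
    by (intro homotopic_with_equal) (auto simp: order_map_def topspace_cyl)
  moreover have "homotopic_with ?P (cyl ?l) X (\<lambda>(t, s). D ((0, t), s)) (\<lambda>(t, s). D ((1, t), s))"
    unfolding homotopic_with_def
  proof (intro exI[of _ "\<lambda>(u, t, s). D ((u, t), s)"] conjI allI ballI)
    show "continuous_map (prod_topology unit_interval (cyl ?l)) X (\<lambda>(u, t, s). D ((u, t), s))"
      unfolding cyl_def diff_Suc_1 by (rule continuous_map_prod_assoc[OF D])
  qed (use D_ends in \<open>auto simp: case_prod_unfold\<close>)
  ultimately have "homotopic_with ?P (cyl ?l) X f (\<lambda>(t, s). D ((1, t), s))"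
    by (rule homotopic_with_trans)
  moreover have "loop_map m x0 (\<lambda>(t, s). D ((1, t), s))"
    using D_base[of 1] H1 D_ends[of 1] by (auto simp: loop_map_def of_order_one_iff)
  ultimately show thesis using that by blast
qed

text \<open>Along a homotopy \<open>K\<close> through maps of order \<open>e\<close> the restriction to \<open>t\<^sub>n = 0\<close> sweeps out maps
  \<open>L\<^sub>r\<close>. Concatenating \<open>K\<^sub>r\<close> with the reverse of \<open>L\<^sub>r\<close> gives a family \<open>E\<close> whose restriction is \<open>L\<^sub>r\<close>
  followed by its reverse; this contracts canonically, through \<open>N\<close>. Homotopy extension along \<open>N\<close> yields
  maps \<open>D\<close> depending on the extension time \<open>u\<close> and on \<open>r\<close>. They are loop maps on three sides of the
  square of pairs \<open>(u, r)\<close>: on \<open>u = 1\<close>, where the contraction is complete, and on \<open>r = 0\<close> and \<open>r = 1\<close>,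
  where \<open>L\<^sub>r\<close> is constant. Running along these sides joins \<open>f\<close> to \<open>f'\<close>, each followed by a constant
  piece.\<close>

lemma homotopic_loop_map:
  assumes f: "loop_map m x0 f" and f': "loop_map m x0 f'"
    and homotopic: "homotopic_with (of_order (Suc (Suc m)) \<phi> x0 \<one>\<^bsub>G\<^esub>) (cyl (Suc (Suc m))) X f f'"
  shows "homotopic_with (loop_map m x0) (cyl (Suc (Suc m))) X f f'"
proof -
  let ?l = "Suc (Suc m)"
  let ?T = "torus (Suc m)" and ?I = unit_interval
  let ?A = "prod_topology ?I ?I"
  let ?b = "\<lambda>s::nat \<Rightarrow> real set. s(?l := circle_class 0)"
  obtain K where K: "continuous_map (prod_topology ?I (prod_topology ?I ?T)) X K"
    and K0: "\<And>z. K (0, z) = f z" and K1: "\<And>z. K (1, z) = f' z"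
    and K_ends': "\<And>r. r \<in> {0..1} \<Longrightarrow> of_order ?l \<phi> x0 \<one>\<^bsub>G\<^esub> (\<lambda>z. K (r, z))"
    using homotopic unfolding homotopic_with_def cyl_def by auto
  have K_ends: "K (r, 0, s) = x0" "K (r, 1, s) = x0" if "r \<in> {0..1}" "s \<in> topspace ?T" for r s
    using K_ends'[OF that(1)] that(2) by (auto simp: of_order_one_iff)
  have b_in: "?b s \<in> topspace ?T" if "s \<in> topspace ?T" for s
  proof -
    have "?b s = ?b (restrict s {2..Suc m})"
      using that by (auto simp: topspace_torus PiE_iff extensional_def fun_eq_iff)
    then show ?thesis using base_in_torus[OF restrict_in_torus[OF that]] by simp
  qed
  have b_cont: "continuous_map ?T ?T ?b"
  proof (rule continuous_map_eq)
    show "continuous_map ?T ?T (\<lambda>s. ?b (restrict s {2..Suc m}))"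
      using continuous_map_compose[OF continuous_map_torus_restrict continuous_map_torus_base]
      by (simp add: o_def)
  qed (auto simp: topspace_torus PiE_iff extensional_def fun_eq_iff)
  define E where "E = (\<lambda>((r, t), s). concat_cyl (\<lambda>z. K (r, z)) (\<lambda>(t, s). K (r, 1 - t, ?b s)) (t, s))"
  define N where "N = (\<lambda>(c, (r, t), s). K (r, (1 - c) * (1 - \<bar>1 - 2 * t\<bar>), ?b s))"
  have E: "continuous_map (prod_topology ?A ?T) X E"
  proof -
    let ?C = "prod_topology ?I (prod_topology ?I ?T)"
    have "continuous_map ?C X (concat_cyl (\<lambda>(t, r, s). K (r, t, s)) (\<lambda>(t, r, s). K (r, 1 - t, ?b s)))"
    proof (rule continuous_map_concat_cyl)
      show "continuous_map ?C X (\<lambda>(t, r, s). K (r, t, s))"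
        unfolding case_prod_unfold
        by (intro continuous_map_apply_pair[OF K] continuous_map_pairedI continuous_map_fst
            continuous_map_compose[OF continuous_map_snd continuous_map_fst, unfolded o_def]
            continuous_map_compose[OF continuous_map_snd continuous_map_snd, unfolded o_def])
      have "continuous_map ?C ?I (\<lambda>z. 1 - fst z)"
        by (auto simp: continuous_map_into_unit_interval intro!: continuous_intros)
      moreover have "continuous_map ?C ?T (\<lambda>z. ?b (snd (snd z)))"
        using continuous_map_compose[OF continuous_map_compose[OF continuous_map_snd continuous_map_snd] b_cont]
        by (simp add: o_def)
      ultimately show "continuous_map ?C X (\<lambda>(t, r, s). K (r, 1 - t, ?b s))"
        unfolding case_prod_unfold
        by (intro continuous_map_apply_pair[OF K] continuous_map_pairedI
            continuous_map_compose[OF continuous_map_snd continuous_map_fst, unfolded o_def])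
    qed (use K_ends b_in in auto)
    from continuous_map_apply_pair[OF this, of "prod_topology ?A ?T" "\<lambda>z. snd (fst z)" "\<lambda>z. (fst (fst z), snd z)"]
    have "continuous_map (prod_topology ?A ?T) X (\<lambda>z. concat_cyl (\<lambda>(t, r, s). K (r, t, s))
        (\<lambda>(t, r, s). K (r, 1 - t, ?b s)) (snd (fst z), fst (fst z), snd z))"
      using continuous_map_compose[OF continuous_map_fst continuous_map_fst, of ?I ?I ?T]
        continuous_map_compose[OF continuous_map_fst continuous_map_snd, of ?I ?I ?T]
      by (simp add: continuous_map_pairedI continuous_map_snd o_def)
    moreover have "E = (\<lambda>z. concat_cyl (\<lambda>(t, r, s). K (r, t, s))
        (\<lambda>(t, r, s). K (r, 1 - t, ?b s)) (snd (fst z), fst (fst z), snd z))"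
      by (auto simp: E_def concat_cyl_def concat_path_def)
    ultimately show ?thesis by simp
  qed
  have N: "continuous_map (prod_topology ?I (prod_topology ?A (torus m))) X N"
  proof -
    let ?C = "prod_topology ?I (prod_topology ?A (torus m))"
    have proj: "continuous_map ?C ?I (\<lambda>z. fst (fst (snd z)))" "continuous_map ?C ?I (\<lambda>z. snd (fst (snd z)))"
      "continuous_map ?C (torus m) (\<lambda>z. snd (snd z))"
      using continuous_map_compose[OF continuous_map_compose[OF continuous_map_snd continuous_map_fst] continuous_map_fst, of ?I ?I ?I "torus m"]
        continuous_map_compose[OF continuous_map_compose[OF continuous_map_snd continuous_map_fst] continuous_map_snd, of ?I ?I ?I "torus m"]
        continuous_map_compose[OF continuous_map_snd continuous_map_snd, of ?I ?A "torus m"]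
      by (simp_all add: o_def)
    have "continuous_map ?C ?I (\<lambda>z. (1 - fst z) * (1 - \<bar>1 - 2 * snd (fst (snd z))\<bar>))"
      unfolding continuous_map_into_unit_interval
    proof (intro conjI ballI)
      show "continuous_map ?C euclideanreal (\<lambda>z. (1 - fst z) * (1 - \<bar>1 - 2 * snd (fst (snd z))\<bar>))"
        by (intro continuous_map_real_mult continuous_map_diff continuous_map_real_abs
            continuous_map_canonical_const continuous_map_real_fst[of _ "prod_topology ?A (torus m)" "\<lambda>z. z"]
            continuous_map_id[unfolded id_def] proj(2)[unfolded continuous_map_into_unit_interval, THEN conjunct1])
    qed (auto intro!: mult_le_one)
    moreover have "continuous_map ?C ?T (\<lambda>z. ?b (snd (snd z)))"
      using continuous_map_compose[OF proj(3) continuous_map_torus_base] by (simp add: o_def)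
    ultimately show ?thesis
      unfolding N_def case_prod_unfold
      by (intro continuous_map_apply_pair[OF K] continuous_map_pairedI proj)
  qed
  have NE: "N (0, a, s) = E (a, s(?l := circle_class 0))" for a s
    by (cases a) (auto simp: N_def E_def concat_cyl_def concat_path_def abs_if)
  obtain D where D: "continuous_map (prod_topology (prod_topology ?I ?A) ?T) X D"
    and D0: "\<And>a s. a \<in> topspace ?A \<Longrightarrow> s \<in> topspace ?T \<Longrightarrow> D ((0, a), s) = E (a, s)"
    and D_base: "\<And>u a s. u \<in> {0..1} \<Longrightarrow> a \<in> topspace ?A \<Longrightarrow> s \<in> topspace ?T \<Longrightarrow>
      s ?l = circle_class 0 \<Longrightarrow> D ((u, a), s) = N (u, a, restrict s {2..Suc m})"
    and D_const: "\<And>u a s c. u \<in> {0..1} \<Longrightarrow> s \<in> topspace ?T \<Longrightarrow>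
      \<forall>s\<in>topspace ?T. E (a, s) = c \<Longrightarrow>
      \<forall>u\<in>{0..1}. \<forall>s\<in>topspace (torus m). N (u, a, s) = c \<Longrightarrow> D ((u, a), s) = c"
    by (rule homotopy_extension_torus[OF square_compact_Hausdorff E N NE]) auto
  \<comment> \<open>Over the ends of the first coordinate both \<open>E\<close> and \<open>N\<close> are constant for every \<open>r\<close>.\<close>
  have D_ends: "D ((u, r, t), s) = x0"
    if "u \<in> {0..1}" "r \<in> {0..1}" "t = 0 \<or> t = 1" "s \<in> topspace ?T" for u r t s
  proof (rule D_const[OF that(1,4)])
    have "E ((r, t), s) = x0" if "s \<in> topspace ?T" for s
      using K_ends[OF \<open>r \<in> {0..1}\<close>] that \<open>t = 0 \<or> t = 1\<close> b_in[OF that]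
      by (auto simp: E_def concat_cyl_def concat_path_def)
    then show "\<forall>s\<in>topspace ?T. E ((r, t), s) = x0" by blast
    have "N (u, (r, t), s) = x0" if "u \<in> {0..1}" "s \<in> topspace (torus m)" for u s
      using K_ends[OF \<open>r \<in> {0..1}\<close> base_in_torus[OF that(2)]] \<open>t = 0 \<or> t = 1\<close>
      by (auto simp: N_def)
    then show "\<forall>u\<in>{0..1}. \<forall>s\<in>topspace (torus m). N (u, (r, t), s) = x0" by blast
  qed
  have shrink: "(1 - u) * (1 - \<bar>1 - 2 * t\<bar>) \<in> {0..1}" if "u \<in> {0..1}" "t \<in> {0..1}" for u t :: real
    using that by (auto intro!: mult_le_one)
  have loop_D: "loop_map m x0 (\<lambda>(t, s). D ((u, r, t), s))"
    if u: "u \<in> {0..1}" and r: "r \<in> {0..1}" and edge: "u = 1 \<or> r = 0 \<or> r = 1" for u r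
    unfolding loop_map_def prod.case
  proof (intro ballI impI)
    fix t s assume t: "t \<in> {0..1::real}" and s: "s \<in> topspace ?T"
      and boundary: "t = 0 \<or> t = 1 \<or> s ?l = circle_class 0"
    show "D ((u, r, t), s) = x0"
    proof (cases "s ?l = circle_class 0")
      case True
      have "D ((u, r, t), s) = K (r, (1 - u) * (1 - \<bar>1 - 2 * t\<bar>), s)"
        using D_base[OF u _ s True, of "(r, t)"] r t torus_with_base_coordinate[OF s True]
        by (simp add: N_def)
      also have "\<dots> = x0"
        using edge
      proof (elim disjE)
        assume "u = 1" then show ?thesis using K_ends[OF r s] by simp
      next
        assume "r = 0" then show ?thesis
          using f s True shrink[OF u t] by (simp add: K0 loop_map_def)
      next
        assume "r = 1" then show ?thesis
          using f' s True shrink[OF u t] by (simp add: K1 loop_map_def)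
      qed
      finally show ?thesis .
    next
      case False
      then show ?thesis using D_ends[OF u r _ s] boundary by blast
    qed
  qed
  have path_D: "homotopic_with (loop_map m x0) (cyl ?l) X
      (\<lambda>(t, s). D ((a 0, b 0, t), s)) (\<lambda>(t, s). D ((a 1, b 1, t), s))"
    if a: "continuous_map ?I ?I a" and b: "continuous_map ?I ?I b"
      and edge: "\<And>w. w \<in> {0..1} \<Longrightarrow> a w = 1 \<or> b w = 0 \<or> b w = 1" for a b
    unfolding homotopic_with_def
  proof (intro exI[of _ "\<lambda>(w, t, s). D ((a w, b w, t), s)"] conjI allI ballI)
    show "continuous_map (prod_topology ?I (cyl ?l)) X (\<lambda>(w, t, s). D ((a w, b w, t), s))"
      unfolding case_prod_unfold cyl_def
      by simp (intro continuous_map_apply_pair[OF D] continuous_map_pairedI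
          continuous_map_compose[OF continuous_map_fst a, unfolded o_def]
          continuous_map_compose[OF continuous_map_fst b, unfolded o_def]
          continuous_map_compose[OF continuous_map_snd continuous_map_fst, unfolded o_def]
          continuous_map_compose[OF continuous_map_snd continuous_map_snd, unfolded o_def])
    show "loop_map m x0 (\<lambda>z. (\<lambda>(w, t, s). D ((a w, b w, t), s)) (w, z))" if "w \<in> {0..1}" for w
    proof -
      have "a w \<in> {0..1}" "b w \<in> {0..1}"
        using a b that by (auto simp: continuous_map_into_unit_interval)
      then show ?thesis using loop_D edge[OF that] by simp
    qed
  qed auto
  have reverse: "continuous_map ?I ?I (\<lambda>w. 1 - w)"
    by (auto simp: continuous_map_into_unit_interval intro!: continuous_intros)
  have D00: "homotopic_with (loop_map m x0) (cyl ?l) X k (\<lambda>(t, s). D ((0, r, t), s))"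
    if r: "r = 0 \<or> r = 1" and k: "\<And>z. K (r, z) = k z" and loop_k: "loop_map m x0 k"
      and k_cont: "continuous_map (cyl ?l) X k" for k r
  proof -
    \<comment> \<open>The appended reverse of \<open>L\<^sub>r\<close> is constant here, so \<open>E\<close> runs through \<open>k\<close> at double speed and
      then rests.\<close>
    let ?\<rho> = "\<lambda>t::real. min 1 (2 * t)"
    have E_r: "E ((r, t), s) = k (?\<rho> t, s)" if "t \<in> {0..1}" "s \<in> topspace ?T" for t s
    proof (cases "t \<le> 1/2")
      case True
      then show ?thesis by (simp add: E_def concat_cyl_def concat_path_def k min_absorb2)
    next
      case False
      then show ?thesis
        using loop_k loop_map_ends(2)[OF loop_k that(2)] that b_in[OF that(2)]
        by (simp add: E_def concat_cyl_def concat_path_def k loop_map_def)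
    qed
    have "homotopic_with (loop_map m x0) (cyl ?l) X (\<lambda>(t, s). k (t, s)) (\<lambda>(t, s). k (?\<rho> t, s))"
      unfolding cyl_def
    proof (rule homotopic_reparametrize)
      show "continuous_map (prod_topology ?I (torus (?l - 1))) X k"
        using k_cont by (simp add: cyl_def)
      have "continuous_on {0..1} ?\<rho>" by (intro continuous_intros)
      then show "continuous_map ?I ?I ?\<rho>"
        by (simp add: continuous_map_into_unit_interval)
      show "loop_map m x0 (\<lambda>(t, s). k (\<tau> t, s))"
        if "\<tau> \<in> {0..1} \<rightarrow> {0..1}" "\<tau> 0 = 0" "\<tau> 1 = 1" for \<tau> :: "real \<Rightarrow> real"
        unfolding loop_map_def prod.case
      proof (intro ballI impI)
        fix t s assume "t \<in> {0..1::real}" "s \<in> topspace ?T" "t = 0 \<or> t = 1 \<or> s ?l = circle_class 0"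
        then have "\<tau> t \<in> {0..1}" "s \<in> topspace ?T" "\<tau> t = 0 \<or> \<tau> t = 1 \<or> s ?l = circle_class 0"
          using that by auto
        then show "k (\<tau> t, s) = x0" using loop_k unfolding loop_map_def by blast
      qed
    qed auto
    moreover have "homotopic_with (loop_map m x0) (cyl ?l) X (\<lambda>(t, s). D ((0, r, t), s)) (\<lambda>(t, s). k (?\<rho> t, s))"
    proof (rule homotopic_with_equal)
      show "continuous_map (cyl ?l) X (\<lambda>(t, s). D ((0, r, t), s))"
        using homotopic_with_imp_continuous_maps[OF path_D[of "\<lambda>_. 0" "\<lambda>_. r"]] r by auto
      show "loop_map m x0 (\<lambda>(t, s). k (?\<rho> t, s))"
        using homotopic_with_imp_property[OF calculation] by blast
      show "loop_map m x0 (\<lambda>(t, s). D ((0, r, t), s))" using loop_D[of 0 r] r by auto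
      show "(\<lambda>(t, s). D ((0, r, t), s)) z = (\<lambda>(t, s). k (?\<rho> t, s)) z" if "z \<in> topspace (cyl ?l)" for z
        using that D0[of "(r, fst z)" "snd z"] E_r r by (auto simp: topspace_cyl)
    qed
    ultimately have "homotopic_with (loop_map m x0) (cyl ?l) X (\<lambda>(t, s). k (t, s)) (\<lambda>(t, s). D ((0, r, t), s))"
      by (rule homotopic_with_trans[OF _ homotopic_with_symD])
    then show ?thesis by (simp only: case_prod_eta)
  qed
  have f_cont: "continuous_map (cyl ?l) X f" "continuous_map (cyl ?l) X f'"
    using homotopic_with_imp_continuous_maps[OF homotopic] by auto
  have "homotopic_with (loop_map m x0) (cyl ?l) X f (\<lambda>(t, s). D ((0, 0, t), s))"
    by (rule D00[OF _ K0 f f_cont(1)]) simp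
  moreover have "homotopic_with (loop_map m x0) (cyl ?l) X
      (\<lambda>(t, s). D ((0, 0, t), s)) (\<lambda>(t, s). D ((1, 0, t), s))"
    using path_D[of "\<lambda>w. w" "\<lambda>_. 0"] by simp
  moreover have "homotopic_with (loop_map m x0) (cyl ?l) X
      (\<lambda>(t, s). D ((1, 0, t), s)) (\<lambda>(t, s). D ((1, 1, t), s))"
    using path_D[of "\<lambda>_. 1" "\<lambda>w. w"] by simp
  moreover have "homotopic_with (loop_map m x0) (cyl ?l) X
      (\<lambda>(t, s). D ((1, 1, t), s)) (\<lambda>(t, s). D ((0, 1, t), s))"
    using path_D[of "\<lambda>w. 1 - w" "\<lambda>_. 1"] reverse by simp
  moreover have "homotopic_with (loop_map m x0) (cyl ?l) X f' (\<lambda>(t, s). D ((0, 1, t), s))"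
    by (rule D00[OF _ K1 f' f_cont(2)]) simp
  ultimately show ?thesis
    by (meson homotopic_with_trans homotopic_with_symD)
qed

end


section \<open>The torus homotopy group of the loop space\<close>

definition loop_uncurry ::
    "nat \<Rightarrow> (real \<Rightarrow> (nat \<Rightarrow> real set) \<Rightarrow> real \<Rightarrow> 'x) \<Rightarrow> real \<times> (nat \<Rightarrow> real set) \<Rightarrow> 'x" where
  "loop_uncurry m p = (\<lambda>(t, s). p t (restrict s {2..Suc m}) (circle_rep (s (Suc (Suc m)))))"

definition loop_curry ::
    "nat \<Rightarrow> (real \<times> (nat \<Rightarrow> real set) \<Rightarrow> 'x) \<Rightarrow> real \<Rightarrow> (nat \<Rightarrow> real set) \<Rightarrow> real \<Rightarrow> 'x" where
  "loop_curry m f =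
     (\<lambda>t. \<lambda>s\<in>topspace (torus m). \<lambda>u\<in>{0..1}. f (t, s(Suc (Suc m) := circle_class u)))"

lemma loop_uncurry_concat:
  "loop_uncurry m (concat_path p q) = concat_cyl (loop_uncurry m p) (loop_uncurry m q)"
  by (auto simp: loop_uncurry_def concat_cyl_def concat_path_def)

lemma unloop_eq_loop_uncurry:
  "unloop (Suc (Suc m)) p = (\<lambda>t. \<lambda>s\<in>topspace (torus (Suc m)). loop_uncurry m p (t, s))"
  by (simp add: unloop_def loop_uncurry_def circle_rep_def)

lemma topspace_loop_space:
  "p \<in> topspace (loop_space X x0) \<longleftrightarrow> p \<in> maps unit_interval X \<and> p 0 = x0 \<and> p 1 = x0"
  by (simp add: loop_space_def)

lemma loop_map_loop_uncurry:
  assumes p: "continuous_map unit_interval (mapping_space (torus m) (loop_space X x0)) p"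
    and based: "based_loop (const_map (torus m) (const_loop x0)) p"
  shows "loop_map m x0 (loop_uncurry m p)"
  unfolding loop_map_def
proof (intro ballI impI)
  fix t s assume t: "t \<in> {0..1::real}" and s: "s \<in> topspace (torus (Suc m))"
    and boundary: "t = 0 \<or> t = 1 \<or> s (Suc (Suc m)) = circle_class 0"
  let ?s = "restrict s {2..Suc m}" and ?u = "circle_rep (s (Suc (Suc m)))"
  have s': "?s \<in> topspace (torus m)" by (rule restrict_in_torus[OF s])
  have "p t \<in> maps (torus m) (loop_space X x0)"
    using continuous_map_image_subset_topspace[OF p] t by auto
  then have loop: "p t ?s 0 = x0" "p t ?s 1 = x0"
    using s' continuous_map_image_subset_topspace[of "torus m" "loop_space X x0" "p t"]
    by (auto simp: maps_def topspace_loop_space)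
  have u: "?u \<in> {0..1}"
    using in_torus_coord[OF s, of "Suc (Suc m)"] circle_rep_in_unit_interval by simp
  show "loop_uncurry m p (t, s) = x0"
  proof (cases "s (Suc (Suc m)) = circle_class 0")
    case True
    then show ?thesis
      using loop circle_rep_cases[of 0] by (auto simp: loop_uncurry_def)
  next
    case False
    then have "p t = const_map (torus m) (const_loop x0)"
      using boundary based by (auto simp: based_loop_def)
    with s' u show ?thesis
      by (simp add: loop_uncurry_def const_map_def const_loop_def)
  qed
qed

lemma loop_curry_uncurry:
  assumes F: "p t \<in> topspace (mapping_space (torus m) (loop_space X x0))"
  shows "loop_curry m (loop_uncurry m p) t = p t"
proof -
  have loops: "p t s \<in> topspace (loop_space X x0)" if "s \<in> topspace (torus m)" for s
    using F continuous_map_image_subset_topspace that by (fastforce simp: maps_def)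
  have "loop_curry m (loop_uncurry m p) t s u = p t s u"
    if s: "s \<in> topspace (torus m)" and u: "u \<in> {0..1}" for s u
    using loops[OF s] apply_circle_rep[OF u, of "p t s"] s u
    by (simp add: loop_curry_def loop_uncurry_def restrict_torus topspace_loop_space)
  moreover have "loop_curry m (loop_uncurry m p) t s u = p t s u"
    if s: "s \<in> topspace (torus m)" and u: "u \<notin> {0..1}" for s u
    using loops[OF s] s u by (auto simp: loop_curry_def topspace_loop_space maps_def extensional_def)
  moreover have "loop_curry m (loop_uncurry m p) t s = p t s" if "s \<notin> topspace (torus m)" for s
    using F that by (auto simp: loop_curry_def maps_def extensional_def)
  ultimately show ?thesis by (intro ext) metis
qed

lemma loop_uncurry_curry:
  assumes "s \<in> topspace (torus (Suc m))"
  shows "loop_uncurry m (loop_curry m f) (t, s) = f (t, s)"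
proof -
  have "s (Suc (Suc m)) \<in> topspace circle_top" using in_torus_coord[OF assms] by simp
  then show ?thesis
    using circle_rep_in_unit_interval[of "s (Suc (Suc m))"] circle_class_rep[of "s (Suc (Suc m))"]
      restrict_in_torus[OF assms] fun_upd_restrict_torus[OF assms]
    by (simp add: loop_uncurry_def loop_curry_def)
qed

lemma based_loop_curry:
  assumes "loop_map m x0 f"
  shows "based_loop (const_map (torus m) (const_loop x0)) (loop_curry m f)"
proof -
  have "f (t, s(Suc (Suc m) := circle_class u)) = x0"
    if "t = 0 \<or> t = 1" "s \<in> topspace (torus m)" "u \<in> {0..1}" for t s u
    using loop_map_ends[OF assms fun_upd_in_torus[OF that(2) circle_class_in_circle_top[OF that(3)]]] that(1)
    by blast
  then show ?thesis
    by (auto simp: based_loop_def loop_curry_def const_map_def const_loop_def intro!: restrict_ext)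
qed

lemma homotopic_loop_uncurry:
  assumes "homotopic_with (based_loop (const_map (torus m) (const_loop x0))) unit_interval
      (mapping_space (torus m) (loop_space X x0)) p p'"
  shows "homotopic_with (loop_map m x0) (cyl (Suc (Suc m))) X (loop_uncurry m p) (loop_uncurry m p')"
proof -
  let ?M = "mapping_space (torus m) (loop_space X x0)"
  obtain h where h: "continuous_map (prod_topology unit_interval unit_interval) ?M h"
    and h01: "\<And>t. h (0, t) = p t" "\<And>t. h (1, t) = p' t"
    and based: "\<And>u. u \<in> {0..1} \<Longrightarrow> based_loop (const_map (torus m) (const_loop x0)) (\<lambda>t. h (u, t))"
    using assms unfolding homotopic_with_def by blast
  note c = continuous_map_prod_assoc[OF continuous_map_loops_uncurry[OF square_compact_Hausdorff h]]
  show ?thesis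
    unfolding homotopic_with_def
  proof (intro exI[of _ "\<lambda>(u, z). loop_uncurry m (\<lambda>t. h (u, t)) z"] conjI allI ballI)
    show "continuous_map (prod_topology unit_interval (cyl (Suc (Suc m)))) X
        (\<lambda>(u, z). loop_uncurry m (\<lambda>t. h (u, t)) z)"
      using c by (simp add: cyl_def loop_uncurry_def case_prod_unfold)
    fix u :: real assume u: "u \<in> {0..1}"
    have "continuous_map unit_interval ?M (\<lambda>t. h (u, t))"
      by (rule continuous_map_apply_pair[OF h]) (use u in auto)
    from loop_map_loop_uncurry[OF this based[OF u]]
    show "loop_map m x0 (\<lambda>z. (\<lambda>(u, z). loop_uncurry m (\<lambda>t. h (u, t)) z) (u, z))" by simp
  qed (simp_all add: h01)
qed

lemma homotopic_loop_curry:
  assumes "homotopic_with (loop_map m x0) (cyl (Suc (Suc m))) X f f'"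
  shows "homotopic_with (based_loop (const_map (torus m) (const_loop x0))) unit_interval
      (mapping_space (torus m) (loop_space X x0)) (loop_curry m f) (loop_curry m f')"
proof -
  let ?I = unit_interval
  obtain h where h: "continuous_map (prod_topology ?I (prod_topology ?I (torus (Suc m)))) X h"
    and h01: "\<And>z. h (0, z) = f z" "\<And>z. h (1, z) = f' z"
    and loop: "\<And>u. u \<in> {0..1} \<Longrightarrow> loop_map m x0 (\<lambda>z. h (u, z))"
    using assms unfolding homotopic_with_def cyl_def by auto
  have "continuous_map (prod_topology ?I ?I) (mapping_space (torus m) (loop_space X x0))
      (\<lambda>y. \<lambda>s\<in>topspace (torus m). \<lambda>u\<in>{0..1}.
        (\<lambda>((a, b), c). h (a, b, c)) (y, s(Suc (Suc m) := circle_class u)))"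
    by (rule continuous_map_loops_curry[OF continuous_map_prod_assoc'[OF h]])
      (use loop in \<open>auto simp: loop_map_def\<close>)
  then have "continuous_map (prod_topology ?I ?I) (mapping_space (torus m) (loop_space X x0))
      (\<lambda>(u, t). loop_curry m (\<lambda>z. h (u, z)) t)"
    by (simp add: loop_curry_def case_prod_unfold)
  then show ?thesis
    unfolding homotopic_with_def
    by (intro exI[of _ "\<lambda>(u, t). loop_curry m (\<lambda>z. h (u, z)) t"])
      (auto simp: h01 intro!: based_loop_curry loop)
qed

definition fox_loop :: "nat \<Rightarrow> 'x topology \<Rightarrow> 'x \<Rightarrow> (real \<Rightarrow> (nat \<Rightarrow> real set) \<Rightarrow> real \<Rightarrow> 'x) \<Rightarrow> bool" where
  "fox_loop m X x0 p \<longleftrightarrow> continuous_map unit_interval (mapping_space (torus m) (loop_space X x0)) p \<and>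
     based_loop (const_map (torus m) (const_loop x0)) p"

abbreviation fox_class :: "nat \<Rightarrow> 'x topology \<Rightarrow> 'x \<Rightarrow> (real \<Rightarrow> (nat \<Rightarrow> real set) \<Rightarrow> real \<Rightarrow> 'x)
    \<Rightarrow> (real \<Rightarrow> (nat \<Rightarrow> real set) \<Rightarrow> real \<Rightarrow> 'x) set" where
  "fox_class m X x0 \<equiv>
     loop_class (mapping_space (torus m) (loop_space X x0)) (const_map (torus m) (const_loop x0))"

lemma fox_loop_homotopic:
  "fox_loop m X x0 p \<Longrightarrow> homotopic_with (based_loop (const_map (torus m) (const_loop x0))) unit_interval
     (mapping_space (torus m) (loop_space X x0)) p p"
  by (simp add: fox_loop_def)

lemma homotopic_imp_fox_loop:
  assumes "homotopic_with (based_loop (const_map (torus m) (const_loop x0))) unit_interval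
     (mapping_space (torus m) (loop_space X x0)) p p'"
  shows "fox_loop m X x0 p" "fox_loop m X x0 p'"
  using homotopic_with_imp_continuous_maps[OF assms] homotopic_with_imp_property[OF assms]
  by (auto simp: fox_loop_def)

lemma fox_loop_uncurry:
  assumes "fox_loop m X x0 p"
  shows "continuous_map (cyl (Suc (Suc m))) X (loop_uncurry m p)" "loop_map m x0 (loop_uncurry m p)"
  using homotopic_with_imp_continuous_maps[OF homotopic_loop_uncurry[OF fox_loop_homotopic[OF assms]]]
    homotopic_with_imp_property[OF homotopic_loop_uncurry[OF fox_loop_homotopic[OF assms]]]
  by auto

lemma fox_loop_curry:
  assumes "continuous_map (cyl (Suc (Suc m))) X f" "loop_map m x0 f"
  shows "fox_loop m X x0 (loop_curry m f)"
  by (rule homotopic_imp_fox_loop(1)[OF homotopic_loop_curry[of m x0 X f f]])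
    (use assms in simp)

text \<open>Currying a homotopy of the uncurried maps gives back \<open>p\<close> and \<open>q\<close> on the unit interval. Continuity of
  \<open>p\<close> and \<open>q\<close> is part of the conclusion, which makes the rule applicable to concatenations.\<close>

lemma homotopic_fox_loopI:
  assumes p: "based_loop (const_map (torus m) (const_loop x0)) p"
      "\<And>t. t \<in> {0..1} \<Longrightarrow> p t \<in> topspace (mapping_space (torus m) (loop_space X x0))"
    and q: "based_loop (const_map (torus m) (const_loop x0)) q"
      "\<And>t. t \<in> {0..1} \<Longrightarrow> q t \<in> topspace (mapping_space (torus m) (loop_space X x0))"
    and pq: "homotopic_with (loop_map m x0) (cyl (Suc (Suc m))) X (loop_uncurry m p) (loop_uncurry m q)"
  shows "homotopic_with (based_loop (const_map (torus m) (const_loop x0))) unit_interval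
     (mapping_space (torus m) (loop_space X x0)) p q"
proof -
  let ?P = "based_loop (const_map (torus m) (const_loop x0))"
    and ?M = "mapping_space (torus m) (loop_space X x0)"
  note c = homotopic_loop_curry[OF pq]
  note cont = homotopic_with_imp_continuous_maps[OF c] and based = homotopic_with_imp_property[OF c]
  have "homotopic_with ?P unit_interval ?M (loop_curry m (loop_uncurry m p)) p"
    "homotopic_with ?P unit_interval ?M (loop_curry m (loop_uncurry m q)) q"
    using cont based p q loop_curry_uncurry[of _ _ m X x0]
    by (auto intro!: homotopic_with_equal)
  then show ?thesis
    using c by (meson homotopic_with_trans homotopic_with_symD)
qed

text \<open>Uncurrying turns concatenation of paths of maps into concatenation of loop maps, for which
  compatibility with homotopy is already known.\<close>

lemma homotopic_fox_concat:
  assumes "homotopic_with (based_loop (const_map (torus m) (const_loop x0))) unit_interval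
      (mapping_space (torus m) (loop_space X x0)) p p'"
    and "homotopic_with (based_loop (const_map (torus m) (const_loop x0))) unit_interval
      (mapping_space (torus m) (loop_space X x0)) q q'"
  shows "homotopic_with (based_loop (const_map (torus m) (const_loop x0))) unit_interval
     (mapping_space (torus m) (loop_space X x0)) (concat_path p q) (concat_path p' q')"
proof -
  have concat: "based_loop (const_map (torus m) (const_loop x0)) (concat_path p q)"
    "\<And>t. t \<in> {0..1} \<Longrightarrow> concat_path p q t \<in> topspace (mapping_space (torus m) (loop_space X x0))"
    if "fox_loop m X x0 p" "fox_loop m X x0 q" for p q
  proof -
    have "p t \<in> topspace (mapping_space (torus m) (loop_space X x0))"
      "q t \<in> topspace (mapping_space (torus m) (loop_space X x0))" if "t \<in> {0..1}" for t
      using \<open>fox_loop m X x0 p\<close> \<open>fox_loop m X x0 q\<close> that continuous_map_image_subset_topspace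
      by (fastforce simp: fox_loop_def)+
    then show "t \<in> {0..1} \<Longrightarrow> concat_path p q t \<in> topspace (mapping_space (torus m) (loop_space X x0))" for t
      by (simp add: concat_path_def)
    show "based_loop (const_map (torus m) (const_loop x0)) (concat_path p q)"
      using that by (simp add: fox_loop_def based_loop_def concat_path_def)
  qed
  have "homotopic_with (loop_map m x0) (cyl (Suc (Suc m))) X
      (concat_cyl (loop_uncurry m p) (loop_uncurry m q))
      (concat_cyl (loop_uncurry m p') (loop_uncurry m q'))"
    unfolding cyl_def
  proof (rule homotopic_concat_cyl)
    show "homotopic_with (loop_map m x0) (prod_topology unit_interval (torus (Suc (Suc m) - 1))) X
        (loop_uncurry m p) (loop_uncurry m p')"
      "homotopic_with (loop_map m x0) (prod_topology unit_interval (torus (Suc (Suc m) - 1))) X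
        (loop_uncurry m q) (loop_uncurry m q')"
      using assms[THEN homotopic_loop_uncurry] by (simp_all add: cyl_def)
    show "loop_map m x0 (concat_cyl k k')" if "loop_map m x0 k" "loop_map m x0 k'"
      for k k' :: "real \<times> (nat \<Rightarrow> real set) \<Rightarrow> 'a"
      using that loop_map_ends[OF that(1)] loop_map_ends[OF that(2)]
      by (auto simp: loop_map_def concat_cyl_def concat_path_def)
    show "k (1, s) = k' (0, s)"
      if "loop_map m x0 k" "loop_map m x0 k'" "s \<in> topspace (torus (Suc (Suc m) - 1))"
      for k k' :: "real \<times> (nat \<Rightarrow> real set) \<Rightarrow> 'a" and s
      using that by (simp add: loop_map_ends)
  qed
  then show ?thesis
    using homotopic_imp_fox_loop[OF assms(1)] homotopic_imp_fox_loop[OF assms(2)]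
    by (intro homotopic_fox_loopI concat) (auto simp: loop_uncurry_concat)
qed

lemma fox_mult:
  assumes p: "fox_loop m X x0 p" and q: "fox_loop m X x0 q"
  shows "fox_class m X x0 p \<otimes>\<^bsub>fox_group (Suc m) (loop_space X x0) (const_loop x0)\<^esub> fox_class m X x0 q
    = fox_class m X x0 (concat_path p q)" "fox_loop m X x0 (concat_path p q)"
proof -
  let ?P = "based_loop (const_map (torus m) (const_loop x0))"
    and ?M = "mapping_space (torus m) (loop_space X x0)"
  let ?H = "homotopy_class ?P unit_interval ?M"
  show "fox_loop m X x0 (concat_path p q)"
    by (rule homotopic_imp_fox_loop(1)[OF homotopic_fox_concat[OF fox_loop_homotopic[OF p] fox_loop_homotopic[OF q]]])
  have inner: "(\<Union>q'\<in>?H q. ?H (concat_path p' q')) = ?H (concat_path p' q)"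
    if "fox_loop m X x0 p'" for p'
    by (rule UN_homotopy_class)
      (use q that in \<open>auto simp: fox_loop_def intro!: homotopic_fox_concat\<close>)
  have "(\<Union>p'\<in>?H p. \<Union>q'\<in>?H q. ?H (concat_path p' q')) = (\<Union>p'\<in>?H p. ?H (concat_path p' q))"
    by (intro SUP_cong refl inner) (auto simp: homotopy_class_def dest: homotopic_imp_fox_loop)
  also have "\<dots> = ?H (concat_path p q)"
    by (rule UN_homotopy_class)
      (use p q in \<open>auto simp: fox_loop_def intro!: homotopic_fox_concat\<close>)
  finally show "fox_class m X x0 p \<otimes>\<^bsub>fox_group (Suc m) (loop_space X x0) (const_loop x0)\<^esub> fox_class m X x0 q
      = fox_class m X x0 (concat_path p q)"
    by (simp add: fox_group_def fundamental_group_def loop_class_eq_homotopy_class)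
qed

lemma carrier_fox_group:
  "carrier (fox_group (Suc m) (loop_space X x0) (const_loop x0)) =
     {fox_class m X x0 p | p. fox_loop m X x0 p}"
  by (simp add: fox_group_def fundamental_group_def fox_loop_def pathin_def)

lemma one_fox_group:
  "\<one>\<^bsub>fox_group (Suc m) (loop_space X x0) (const_loop x0)\<^esub> =
     fox_class m X x0 (\<lambda>_. const_map (torus m) (const_loop x0))"
  by (simp add: fox_group_def fundamental_group_def)

lemma fox_loop_const:
  assumes "x0 \<in> topspace X"
  shows "fox_loop m X x0 (\<lambda>_. const_map (torus m) (const_loop x0))"
proof -
  have "fox_loop m X x0 (loop_curry m (\<lambda>_. x0))"
    by (rule fox_loop_curry) (use assms in \<open>auto simp: loop_map_def\<close>)
  moreover have "loop_curry m (\<lambda>_. x0) = (\<lambda>_. const_map (torus m) (const_loop x0))"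
    by (simp add: loop_curry_def const_map_def const_loop_def)
  ultimately show ?thesis by simp
qed

lemma homotopic_curry_cyl:
  assumes "homotopic_with P (prod_topology unit_interval K) X f f'"
    and "\<And>k s. P k \<Longrightarrow> s \<in> topspace K \<Longrightarrow> k (0, s) = x0 \<and> k (1, s) = x0"
  shows "homotopic_with (based_loop (const_map K x0)) unit_interval (mapping_space K X)
           (\<lambda>t. \<lambda>s\<in>topspace K. f (t, s)) (\<lambda>t. \<lambda>s\<in>topspace K. f' (t, s))"
proof -
  let ?I = unit_interval
  obtain h where h: "continuous_map (prod_topology ?I (prod_topology ?I K)) X h"
    and h01: "\<And>z. h (0, z) = f z" "\<And>z. h (1, z) = f' z"
    and P: "\<And>u. u \<in> {0..1} \<Longrightarrow> P (\<lambda>z. h (u, z))"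
    using assms(1) unfolding homotopic_with_def by auto
  from continuous_map_curry[OF continuous_map_prod_assoc'[OF h]]
  have "continuous_map (prod_topology ?I ?I) (mapping_space K X) (\<lambda>(u, t). \<lambda>s\<in>topspace K. h (u, t, s))"
    by (simp add: case_prod_unfold)
  then show ?thesis
    unfolding homotopic_with_def
    by (intro exI[of _ "\<lambda>(u, t). \<lambda>s\<in>topspace K. h (u, t, s)"])
      (use assms(2)[OF P] in \<open>auto simp: h01 based_loop_def const_map_def\<close>)
qed

lemma homotopic_uncurry_cyl:
  assumes K: "compact_space K" "Hausdorff_space K"
    and "homotopic_with (based_loop (const_map K x0)) unit_interval (mapping_space K X) q q'"
    and P: "\<And>k. (\<And>s. s \<in> topspace K \<Longrightarrow> k (0, s) = x0 \<and> k (1, s) = x0) \<Longrightarrow> P k"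
  shows "homotopic_with P (prod_topology unit_interval K) X (case_prod q) (case_prod q')"
proof -
  let ?I = unit_interval
  obtain h where h: "continuous_map (prod_topology ?I ?I) (mapping_space K X) h"
    and h01: "\<And>z. h (0, z) = q z" "\<And>z. h (1, z) = q' z"
    and based: "\<And>u. u \<in> {0..1} \<Longrightarrow> based_loop (const_map K x0) (\<lambda>z. h (u, z))"
    using assms(3) unfolding homotopic_with_def by auto
  from continuous_map_prod_assoc[OF continuous_map_uncurry[OF K h]]
  have "continuous_map (prod_topology ?I (prod_topology ?I K)) X (\<lambda>(u, t, s). h (u, t) s)"
    by simp
  then show ?thesis
    unfolding homotopic_with_def
    by (intro exI[of _ "\<lambda>(u, t, s). h (u, t) s"])
      (use based in \<open>auto simp: h01 based_loop_def const_map_def intro!: P\<close>)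
qed

section \<open>The split exact sequence\<close>

text \<open>A set with a multiplication inherits the group laws from a subgroup onto which it is mapped bijectively
  and multiplicatively.\<close>

lemma group_hom_of_injective_image:
  assumes B: "group B" and H: "subgroup (i ` carrier A) B" and inj: "inj_on i (carrier A)"
    and closed: "\<And>x y. x \<in> carrier A \<Longrightarrow> y \<in> carrier A \<Longrightarrow> x \<otimes>\<^bsub>A\<^esub> y \<in> carrier A"
    and mult: "\<And>x y. x \<in> carrier A \<Longrightarrow> y \<in> carrier A \<Longrightarrow> i (x \<otimes>\<^bsub>A\<^esub> y) = i x \<otimes>\<^bsub>B\<^esub> i y"
    and one: "\<one>\<^bsub>A\<^esub> \<in> carrier A" "i \<one>\<^bsub>A\<^esub> = \<one>\<^bsub>B\<^esub>"
  shows "group_hom A B i"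
proof -
  interpret B: group B by (rule B)
  have in_B: "i x \<in> carrier B" if "x \<in> carrier A" for x
    using subgroup.subset[OF H] that by blast
  have "group A"
  proof (rule groupI)
    show "x \<otimes>\<^bsub>A\<^esub> y \<otimes>\<^bsub>A\<^esub> z = x \<otimes>\<^bsub>A\<^esub> (y \<otimes>\<^bsub>A\<^esub> z)"
      if "x \<in> carrier A" "y \<in> carrier A" "z \<in> carrier A" for x y z
      by (rule inj_onD[OF inj]) (use that in \<open>simp_all add: closed mult in_B B.m_assoc\<close>)
    show "\<one>\<^bsub>A\<^esub> \<otimes>\<^bsub>A\<^esub> x = x" if "x \<in> carrier A" for x
      by (rule inj_onD[OF inj]) (use that in \<open>simp_all add: closed mult in_B one\<close>)
    show "\<exists>y\<in>carrier A. y \<otimes>\<^bsub>A\<^esub> x = \<one>\<^bsub>A\<^esub>" if x: "x \<in> carrier A" for x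
    proof -
      have "inv\<^bsub>B\<^esub> i x \<in> i ` carrier A"
        using subgroup.m_inv_closed[OF H] x by blast
      then obtain y where y: "y \<in> carrier A" and eq: "i y = inv\<^bsub>B\<^esub> i x" by auto
      have "y \<otimes>\<^bsub>A\<^esub> x = \<one>\<^bsub>A\<^esub>"
        by (rule inj_onD[OF inj]) (use x y in \<open>simp_all add: closed mult in_B one eq\<close>)
      with y show ?thesis by blast
    qed
  qed (use closed one in auto)
  then show ?thesis
    using B in_B mult by (auto intro!: group_hom.intro group_hom_axioms.intro homI)
qed

context pointed_G_space
begin

text \<open>On representatives the left-hand map of the sequence is just uncurrying.\<close>

lemma fox_to_rhodes_class:
  assumes p: "fox_loop m X x0 p"
  shows "order_map (Suc (Suc m)) \<one>\<^bsub>G\<^esub> (loop_uncurry m p)"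
    and "(fox_to_rhodes (Suc (Suc m)) X x0 G \<phi> \<circ> fox_map (Suc (Suc m)) X x0) (fox_class m X x0 p)
           = rhodes_class (Suc (Suc m)) X x0 \<phi> (loop_uncurry m p) \<one>\<^bsub>G\<^esub>"
proof -
  let ?n = "Suc (Suc m)" and ?T = "torus (Suc m)" and ?f = "loop_uncurry m p"
  let ?P = "of_order ?n \<phi> x0 \<one>\<^bsub>G\<^esub>"
  let ?Q = "based_loop (const_map ?T x0)" and ?M = "mapping_space ?T X"
  have cyl: "cyl ?n = prod_topology unit_interval ?T" by (simp add: cyl_def)
  show f: "order_map ?n \<one>\<^bsub>G\<^esub> ?f"
    using fox_loop_uncurry[OF p] loop_map_imp_of_order group_G
    by (simp add: order_map_def group.is_monoid monoid.one_closed)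
  have unloop: "homotopic_with ?Q unit_interval ?M (unloop ?n p) (unloop ?n p')"
    if "homotopic_with (based_loop (const_map (torus m) (const_loop x0))) unit_interval
      (mapping_space (torus m) (loop_space X x0)) p p'" for p'
    unfolding unloop_eq_loop_uncurry
    by (rule homotopic_curry_cyl[OF homotopic_loop_uncurry[OF that, unfolded cyl]])
      (auto simp: loop_map_ends)
  have "fox_map ?n X x0 (fox_class m X x0 p) = homotopy_class ?Q unit_interval ?M (unloop ?n p)"
    unfolding fox_map_def loop_class_eq_homotopy_class diff_Suc_1
    by (rule UN_homotopy_class) (use p unloop in \<open>auto simp: fox_loop_def\<close>)
  moreover have "(\<Union>q\<in>homotopy_class ?Q unit_interval ?M (unloop ?n p).
        homotopy_class ?P (cyl ?n) X (case_prod q))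
      = homotopy_class ?P (cyl ?n) X (case_prod (unloop ?n p))"
  proof (rule UN_homotopy_class)
    note u = unloop[OF fox_loop_homotopic[OF p]]
    show "continuous_map unit_interval ?M (unloop ?n p)" "?Q (unloop ?n p)"
      using homotopic_with_imp_continuous_maps[OF u] homotopic_with_imp_property[OF u] by auto
    show "homotopic_with ?P (cyl ?n) X (case_prod (unloop ?n p)) (case_prod q)"
      if "homotopic_with ?Q unit_interval ?M (unloop ?n p) q" for q
      unfolding cyl
      by (rule homotopic_uncurry_cyl[OF compact_torus Hausdorff_torus that])
        (simp add: of_order_one_iff)
  qed
  moreover have "homotopic_with ?P (cyl ?n) X ?f (case_prod (unloop ?n p))"
    using f by (intro homotopic_with_equal)
      (auto simp: order_map_def of_order_one_iff unloop_eq_loop_uncurry topspace_cyl)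
  ultimately show "(fox_to_rhodes ?n X x0 G \<phi> \<circ> fox_map ?n X x0) (fox_class m X x0 p)
      = rhodes_class ?n X x0 \<phi> ?f \<one>\<^bsub>G\<^esub>"
    by (simp add: fox_to_rhodes_def rhodes_class_eq_homotopy_class homotopy_class_eq)
qed

lemma rhodes_class_one_eq_iff:
  assumes "order_map n g f"
  shows "rhodes_class n X x0 \<phi> f g = rhodes_class n X x0 \<phi> (\<lambda>_. x0) \<one>\<^bsub>G\<^esub> \<longleftrightarrow>
    g = \<one>\<^bsub>G\<^esub> \<and> homotopic_with (of_order n \<phi> x0 \<one>\<^bsub>G\<^esub>) (cyl n) X f (\<lambda>_. x0)"
  using order_map_const[of n] unfolding rhodes_class_eq_homotopy_class order_map_def
  by (auto dest: homotopy_class_eqD homotopy_class_eq)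

lemma split_short_exact_rhodes:
  fixes m :: nat
  defines "n \<equiv> Suc (Suc m)"
  shows "split_short_exact
           (fox_group (Suc m) (loop_space X x0) (const_loop x0))
           (rhodes_group n X x0 G \<phi>)
           (rhodes_group (Suc m) X x0 G \<phi>)
           (fox_to_rhodes n X x0 G \<phi> \<circ> fox_map n X x0)
           (rhodes_projection n X x0 \<phi>)
           (rhodes_section n X x0 \<phi>)"
proof -
  let ?A = "fox_group (Suc m) (loop_space X x0) (const_loop x0)"
  let ?B = "rhodes_group n X x0 G \<phi>" and ?C = "rhodes_group (Suc m) X x0 G \<phi>"
  let ?i = "fox_to_rhodes n X x0 G \<phi> \<circ> fox_map n X x0"
  let ?p = "rhodes_projection n X x0 \<phi>" and ?s = "rhodes_section n X x0 \<phi>"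
  let ?inc = "\<lambda>s::nat \<Rightarrow> real set. s(n := circle_class 0)" and ?pr = "\<lambda>s::nat \<Rightarrow> real set. restrict s {2..Suc m}"
  have inc: "continuous_map (torus (Suc m - 1)) (torus (n - 1)) ?inc"
    and pr: "continuous_map (torus (n - 1)) (torus (Suc m - 1)) ?pr"
    using continuous_map_torus_base continuous_map_torus_restrict by (simp_all add: n_def)
  have p_eq: "?p = rhodes_induced (Suc m) X x0 \<phi> (cyl_map ?inc)"
    and s_eq: "?s = rhodes_induced n X x0 \<phi> (cyl_map ?pr)"
    by (simp_all add: rhodes_projection_def rhodes_section_def cyl_incl_def cyl_proj_def cyl_map_def n_def)
  have p_hom: "group_hom ?B ?C ?p" and s_hom: "group_hom ?C ?B ?s"
    unfolding p_eq s_eq by (rule rhodes_induced_hom[OF inc], rule rhodes_induced_hom[OF pr])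
  have i_class: "?i (fox_class m X x0 q) = rhodes_class n X x0 \<phi> (loop_uncurry m q) \<one>\<^bsub>G\<^esub>"
    and i_order: "order_map n \<one>\<^bsub>G\<^esub> (loop_uncurry m q)" if "fox_loop m X x0 q" for q
    using fox_to_rhodes_class[OF that] by (simp_all add: n_def)
  have right_inverse: "?p (?s c) = c" if c_in: "c \<in> carrier ?C" for c
  proof -
    obtain f g where f: "order_map (Suc m) g f" and c: "c = rhodes_class (Suc m) X x0 \<phi> f g"
      using c_in unfolding in_carrier_rhodes_group by blast
    note f' = order_map_cyl_map[OF pr f] and f'' = order_map_cyl_map[OF inc order_map_cyl_map[OF pr f]]
    have "homotopic_with (of_order (Suc m) \<phi> x0 g) (cyl (Suc m)) X
        (f \<circ> cyl_map ?pr \<circ> cyl_map ?inc) f"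
      using f f'' restrict_fun_upd_torus
      by (intro homotopic_with_equal) (auto simp: order_map_def topspace_cyl cyl_map_def n_def)
    then show ?thesis
      unfolding c p_eq s_eq
      by (simp add: rhodes_induced_class[OF pr f] rhodes_induced_class[OF inc f'] rhodes_class_eqI)
  qed
  have surj: "?p ` carrier ?B = carrier ?C"
  proof
    show "?p ` carrier ?B \<subseteq> carrier ?C"
      using group_hom.hom_closed[OF p_hom] by blast
    show "carrier ?C \<subseteq> ?p ` carrier ?B"
      using right_inverse group_hom.hom_closed[OF s_hom] by (metis image_eqI subsetI)
  qed
  have i_inj: "inj_on ?i (carrier ?A)"
  proof (rule inj_onI)
    fix a b assume "a \<in> carrier ?A" "b \<in> carrier ?A" and eq: "?i a = ?i b"
    then obtain q r where q: "fox_loop m X x0 q" "a = fox_class m X x0 q"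
      and r: "fox_loop m X x0 r" "b = fox_class m X x0 r"
      unfolding carrier_fox_group by blast
    have "homotopic_with (of_order n \<phi> x0 \<one>\<^bsub>G\<^esub>) (cyl n) X (loop_uncurry m q) (loop_uncurry m r)"
      using eq i_order[OF r(1)] unfolding q(2) r(2) i_class[OF q(1)] i_class[OF r(1)]
      by (auto simp: rhodes_class_eq_homotopy_class order_map_def intro: homotopy_class_eqD)
    then have "homotopic_with (loop_map m x0) (cyl n) X (loop_uncurry m q) (loop_uncurry m r)"
      using fox_loop_uncurry(2)[OF q(1)] fox_loop_uncurry(2)[OF r(1)] unfolding n_def
      by (intro homotopic_loop_map)
    then have "homotopic_with (based_loop (const_map (torus m) (const_loop x0))) unit_interval
        (mapping_space (torus m) (loop_space X x0)) q r"
      using q(1) r(1) continuous_map_image_subset_topspace unfolding n_def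
      by (intro homotopic_fox_loopI) (fastforce simp: fox_loop_def)+
    then show "a = b"
      by (simp add: q(2) r(2) loop_class_eq_homotopy_class homotopy_class_eq)
  qed
  have image: "?i ` carrier ?A = kernel ?B ?C ?p"
  proof (intro equalityI subsetI)
    fix b assume "b \<in> ?i ` carrier ?A"
    then obtain q where q: "fox_loop m X x0 q" and b: "b = rhodes_class n X x0 \<phi> (loop_uncurry m q) \<one>\<^bsub>G\<^esub>"
      unfolding carrier_fox_group by (auto simp: i_class simp del: o_apply)
    note f = i_order[OF q] and f' = order_map_cyl_map[OF inc i_order[OF q]]
    have "homotopic_with (of_order (Suc m) \<phi> x0 \<one>\<^bsub>G\<^esub>) (cyl (Suc m)) X
        (loop_uncurry m q \<circ> cyl_map ?inc) (\<lambda>_. x0)"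
      using f' fox_loop_uncurry(2)[OF q] order_map_const[of "Suc m"] base_in_torus
      by (intro homotopic_with_equal) (auto simp: order_map_def topspace_cyl cyl_map_def n_def loop_map_def)
    then have "?p b = \<one>\<^bsub>?C\<^esub>"
      unfolding b p_eq by (simp add: rhodes_induced_class[OF inc f] rhodes_one rhodes_class_eqI)
    then show "b \<in> kernel ?B ?C ?p"
      using rhodes_class_in_carrier[OF f] by (simp add: kernel_def b)
  next
    fix b assume b: "b \<in> kernel ?B ?C ?p"
    then obtain f g where f: "order_map n g f" and b_eq: "b = rhodes_class n X x0 \<phi> f g"
      unfolding kernel_def in_carrier_rhodes_group by blast
    have "?p b = \<one>\<^bsub>?C\<^esub>" using b by (simp add: kernel_def)
    then have g: "g = \<one>\<^bsub>G\<^esub>"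
      and null: "homotopic_with (of_order (Suc m) \<phi> x0 \<one>\<^bsub>G\<^esub>) (cyl (Suc m)) X (f \<circ> cyl_map ?inc) (\<lambda>_. x0)"
      unfolding b_eq p_eq rhodes_induced_class[OF inc f] rhodes_one
        rhodes_class_one_eq_iff[OF order_map_cyl_map[OF inc f]] by auto
    obtain f' where loop: "loop_map m x0 f'"
      and ff': "homotopic_with (of_order n \<phi> x0 \<one>\<^bsub>G\<^esub>) (cyl n) X f f'"
      using deform_to_loop_map f null unfolding g n_def by blast
    have f'_cont: "continuous_map (cyl n) X f'"
      using homotopic_with_imp_continuous_maps[OF ff'] by blast
    have q: "fox_loop m X x0 (loop_curry m f')"
      using fox_loop_curry f'_cont loop by (simp add: n_def)
    have "homotopic_with (of_order n \<phi> x0 \<one>\<^bsub>G\<^esub>) (cyl n) X f' (loop_uncurry m (loop_curry m f'))"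
      using f'_cont homotopic_with_imp_property[OF ff'] i_order[OF q]
      by (intro homotopic_with_equal) (auto simp: order_map_def topspace_cyl n_def loop_uncurry_curry)
    from homotopic_with_trans[OF ff' this] have "b = ?i (fox_class m X x0 (loop_curry m f'))"
      unfolding b_eq g i_class[OF q] by (rule rhodes_class_eqI)
    then show "b \<in> ?i ` carrier ?A"
      by (rule image_eqI) (use q in \<open>auto simp: carrier_fox_group\<close>)
  qed
  have i_hom: "group_hom ?A ?B ?i"
  proof (rule group_hom_of_injective_image[OF group_rhodes_group _ i_inj])
    show "subgroup (?i ` carrier ?A) ?B"
      unfolding image by (rule group_hom.subgroup_kernel[OF p_hom])
    fix a b assume "a \<in> carrier ?A" "b \<in> carrier ?A"
    then obtain q r where q: "fox_loop m X x0 q" "a = fox_class m X x0 q"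
      and r: "fox_loop m X x0 r" "b = fox_class m X x0 r"
      unfolding carrier_fox_group by blast
    show "a \<otimes>\<^bsub>?A\<^esub> b \<in> carrier ?A"
      unfolding q(2) r(2) fox_mult(1)[OF q(1) r(1)] carrier_fox_group
      using fox_mult(2)[OF q(1) r(1)] by blast
    have e: "\<one>\<^bsub>G\<^esub> \<in> carrier G" "\<one>\<^bsub>G\<^esub> \<otimes>\<^bsub>G\<^esub> \<one>\<^bsub>G\<^esub> = \<one>\<^bsub>G\<^esub>"
      using group_G by (simp_all add: group.is_monoid)
    let ?q = "loop_uncurry m q" and ?r = "loop_uncurry m r"
    have qr: "order_map n \<one>\<^bsub>G\<^esub> (product_map \<one>\<^bsub>G\<^esub> ?q ?r)"
      using order_map_product[OF i_order[OF q(1)] i_order[OF r(1)]] e by simp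
    have "homotopic_with (of_order n \<phi> x0 \<one>\<^bsub>G\<^esub>) (cyl n) X
        (product_map \<one>\<^bsub>G\<^esub> ?q ?r) (concat_cyl ?q ?r)"
    proof (rule homotopic_with_equal)
      show "of_order n \<phi> x0 \<one>\<^bsub>G\<^esub> (concat_cyl ?q ?r)"
        using i_order[OF fox_mult(2)[OF q(1) r(1)]] by (simp add: order_map_def loop_uncurry_concat)
      show "product_map \<one>\<^bsub>G\<^esub> ?q ?r z = concat_cyl ?q ?r z" if z: "z \<in> topspace (cyl n)" for z
      proof (cases "fst z \<le> 1/2")
        case True
        then show ?thesis by (simp add: concat_cyl_def concat_path_def case_prod_unfold)
      next
        case False
        then have "(2 * fst z - 1, snd z) \<in> topspace (cyl n)"
          using z by (auto simp: topspace_cyl)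
        then have "?r (2 * fst z - 1, snd z) \<in> topspace X"
          by (rule order_map_in_topspace[OF i_order[OF r(1)]])
        with False show ?thesis
          by (simp add: concat_cyl_def concat_path_def case_prod_unfold act_one)
      qed
    qed (use qr in \<open>auto simp: order_map_def\<close>)
    then show "?i (a \<otimes>\<^bsub>?A\<^esub> b) = ?i a \<otimes>\<^bsub>?B\<^esub> ?i b"
      unfolding q(2) r(2) fox_mult(1)[OF q(1) r(1)] i_class[OF fox_mult(2)[OF q(1) r(1)]]
        i_class[OF q(1)] i_class[OF r(1)] rhodes_mult[OF i_order[OF q(1)] i_order[OF r(1)]]
      by (simp add: loop_uncurry_concat e rhodes_class_eqI)
  next
    note const = fox_loop_const[OF x0, of m]
    show "\<one>\<^bsub>?A\<^esub> \<in> carrier ?A"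
      unfolding one_fox_group carrier_fox_group using const by blast
    have "homotopic_with (of_order n \<phi> x0 \<one>\<^bsub>G\<^esub>) (cyl n) X
        (loop_uncurry m (\<lambda>_. const_map (torus m) (const_loop x0))) (\<lambda>_. x0)"
    proof (rule homotopic_with_equal)
      show "loop_uncurry m (\<lambda>_. const_map (torus m) (const_loop x0)) z = x0" if "z \<in> topspace (cyl n)" for z
        using that circle_rep_in_unit_interval in_torus_coord[of "snd z" "Suc m" "Suc (Suc m)"]
          restrict_in_torus[of "snd z" m]
        by (auto simp: loop_uncurry_def const_map_def const_loop_def topspace_cyl n_def)
    qed (use i_order[OF const] order_map_const[of n] in \<open>auto simp: order_map_def\<close>)
    then show "?i \<one>\<^bsub>?A\<^esub> = \<one>\<^bsub>?B\<^esub>"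
      unfolding one_fox_group i_class[OF const] rhodes_one by (rule rhodes_class_eqI)
  qed
  show ?thesis
    unfolding split_short_exact_def
    using i_hom p_hom s_hom i_inj image surj right_inverse by blast
qed

end

theorem theorem1p3:
  fixes G :: "('g, 'm) monoid_scheme"
    and X :: "'x topology"
    and x0 :: 'x
    and \<phi> :: "'g \<Rightarrow> 'x \<Rightarrow> 'x"
    and n :: nat
  assumes "group G" and "finite (carrier G)"
    and "k_space X" and "Hausdorff_space X" and "path_connected_space X"
    and "G_space G \<phi> X"
    and "x0 \<in> topspace X"
    and "n \<ge> 2"
  shows "split_short_exact
           (fox_group (n - 1) (loop_space X x0) (const_loop x0))
           (rhodes_group n X x0 G \<phi>)
           (rhodes_group (n - 1) X x0 G \<phi>)
           (fox_to_rhodes n X x0 G \<phi> \<circ> fox_map n X x0)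
           (rhodes_projection n X x0 \<phi>)
           (rhodes_section n X x0 \<phi>)"
proof -
  interpret pointed_G_space G X x0 \<phi>
    using assms by (intro pointed_G_space.intro)
  have "n = Suc (Suc (n - 2))" using \<open>n \<ge> 2\<close> by simp
  then obtain m where "n = Suc (Suc m)" by blast
  then show ?thesis using split_short_exact_rhodes[of m] by simp
qed

end
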